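(* Let $m\ge 1$ be an integer and let $\sigma:\mathbb{R}\to\mathbb{R}$ be infinitely differentiable and not a polynomial. Then $N=\mathcal{O}((n-1)\,\epsilon^{-2/m})$ units suffice for deep networks with binary tree architecture to approximate functions in $W_m^{n,2}$ with accuracy at least $\epsilon$. Precisely: there is a constant $C>0$, depending only on $m$ and $\sigma$, such that for every integer $n\ge 2$, every full binary tree with $n$ leaves, every $f\in W_m^{n,2}$ (with respect to that tree) and every $\epsilon\in(0,1)$, there exist an integer $N\le C\,(n-1)\,\epsilon^{-2/m}$ and a deep network $P\in\mathcal{D}_{N,2}$ with the same tree as $f$ such that $\max_{x\in[-1,1]^n}|f(x)-P(x)|\le\epsilon$.
   Context: For an integer $d\ge1$, $W_m^d$ is the set of functions $h:[-1,1]^d\to\mathbb{R}$ with continuous partial derivatives of all orders up to $m$ such that $\|h\|+\sum_{1\le|\mathbf{k}|_1\le m}\|D^{\mathbf{k}}h\|\le 1$, where $\|\cdot\|$ is the sup norm on $[-1,1]^d$, $\mathbf{k}$ is a multi-index and $|\mathbf{k}|_1$ is the sum of its components. Shallow networks: $\mathcal{S}_{M,d}$ is the set of functions on $\mathbb{R}^d$ of the form $x\mapsto\sum_{k=1}^M a_k\sigma(\langle w_k,x\rangle+b_k)$ with $w_k\in\mathbb{R}^d$, $a_k,b_k\in\mathbb{R}$. Fix a full binary tree (each non-leaf vertex has exactly two children) whose $n$ leaves are labelled by the variables $x_1,\dots,x_n$; it has $n-1$ non-leaf vertices, forming the set $V$. A compositional function with this tree is obtained by assigning to each $v\in V$ a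 function $h_v$ of two variables (a constituent function), evaluated at the values produced by the two children of $v$ (a leaf produces its variable); the output is the value at the root. For example, with $n=8$: $f=h_3(h_{21}(h_{11}(x_1,x_2),h_{12}(x_3,x_4)),h_{22}(h_{13}(x_5,x_6),h_{14}(x_7,x_8)))$. $W_m^{n,2}$ is the set of compositional functions of $n$ variables on $[-1,1]^n$ with the given binary tree, all of whose constituent functions belong to $W_m^2$ (these take values in $[-1,1]$, so the compositions make sense). $\mathcal{D}_{N,2}$ is the set of deep networks with the given binary tree: compositional functions with that tree in which every constituent function belongs to $\mathcal{S}_{M,2}$, where $N=|V|M$ is the total number of units (the complexity). *)

theory Defs
  imports "HOL-Analysis.Analysis" "HOL-Computational_Algebra.Polynomial"
begin

section \<open>The smoothness classes on the cube\<close>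

definition cube :: "(real ^ 'd) set" where
  "cube = {x. \<forall>i. x $ i \<in> {-1..1}}"

definition sup_norm :: "(real ^ 'd \<Rightarrow> real) \<Rightarrow> real" where
  "sup_norm h = (SUP x\<in>cube. \<bar>h x\<bar>)"

text \<open>The partial derivative in direction \<open>i\<close>, taken within the cube; hence it is the one-sided
  derivative at the faces of the cube orthogonal to that direction, and the values of a function
  outside the cube are irrelevant.\<close>

definition has_partial :: "(real ^ 'd \<Rightarrow> real) \<Rightarrow> 'd \<Rightarrow> real \<Rightarrow> real ^ 'd \<Rightarrow> bool" where
  "has_partial h i c x \<longleftrightarrow>
     ((\<lambda>t. h (x + t *\<^sub>R axis i 1)) has_real_derivative c)
       (at 0 within {t. x + t *\<^sub>R axis i 1 \<in> cube})"

definition msize :: "('d::finite \<Rightarrow> nat) \<Rightarrow> nat" where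
  "msize k = (\<Sum>i\<in>UNIV. k i)"

text \<open>\<open>D\<close> lists all partial derivatives of \<open>h\<close> up to order \<open>m\<close>, indexed by multi-indices: whichever
  coordinate is differentiated next, \<open>D k\<close> turns into \<open>D\<close> at the incremented multi-index.\<close>

definition partials_upto ::
    "nat \<Rightarrow> (real ^ 'd \<Rightarrow> real) \<Rightarrow> (('d \<Rightarrow> nat) \<Rightarrow> real ^ 'd \<Rightarrow> real) \<Rightarrow> bool" where
  "partials_upto m h D \<longleftrightarrow>
     D (\<lambda>_. 0) = h \<and>
     (\<forall>k i. msize k < m \<longrightarrow> (\<forall>x\<in>cube. has_partial (D k) i (D (k(i := Suc (k i))) x) x)) \<and>
     (\<forall>k. msize k \<le> m \<longrightarrow> continuous_on cube (D k))"

definition W :: "nat \<Rightarrow> (real ^ 'd \<Rightarrow> real) set" where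
  "W m = {h. \<exists>D. partials_upto m h D \<and>
            sup_norm h + (\<Sum>k | 1 \<le> msize k \<and> msize k \<le> m. sup_norm (D k)) \<le> 1}"

text \<open>The family of partial derivatives is determined by \<open>h\<close> on the cube, so the existential
  quantifier in the definition of \<open>W\<close> only names the derivatives.\<close>

lemma has_partial_unique:
  assumes "has_partial f i a x" "has_partial g i b x" "x \<in> cube" "\<And>y. y \<in> cube \<Longrightarrow> f y = g y"
  shows "a = b"
proof -
  let ?S = "{t. x + t *\<^sub>R axis i 1 \<in> cube}"
  have S: "?S = {-1 - x $ i .. 1 - x $ i}"
    using assms(3) by (force simp: cube_def axis_def)
  have "((\<lambda>t. g (x + t *\<^sub>R axis i 1)) has_real_derivative a) (at 0 within ?S)"
    using assms(1) unfolding has_partial_def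
    by (rule has_field_derivative_transform_within[OF _ zero_less_one])
       (use assms(3,4) in auto)
  moreover have "x $ i \<in> {-1..1}"
    using assms(3) by (auto simp: cube_def)
  ultimately show ?thesis
    using assms(2) unfolding has_partial_def S has_real_derivative_iff_has_vector_derivative
    by (intro vector_derivative_unique_within_closed_interval
          [of "-1 - x $ i" "1 - x $ i" 0 "\<lambda>t. g (x + t *\<^sub>R axis i 1)" a b]) auto
qed

lemma partials_upto_unique:
  assumes "partials_upto m h D" "partials_upto m h E" "msize k \<le> m" "x \<in> cube"
  shows "D k x = E k x"
  using assms(3,4)
proof (induction "msize k" arbitrary: k x)
  case 0
  then have "k = (\<lambda>_. 0)"
    by (auto simp: msize_def)
  then show ?case
    using assms(1,2) by (simp add: partials_upto_def)
next
  case (Suc n)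
  then obtain i where i: "k i \<noteq> 0"
    by (metis msize_def sum.neutral nat.distinct(1))
  define l where "l = k(i := k i - 1)"
  have k: "k = l(i := Suc (l i))"
    using i by (auto simp: l_def)
  have "msize k = Suc (msize l)"
    by (subst k) (simp add: msize_def sum.remove[of UNIV i])
  then have n: "n = msize l" and l: "msize l < m"
    using Suc.hyps(2) Suc.prems by auto
  have "has_partial (F l) i (F k x) x" if "partials_upto m h F" for F
  proof -
    have "has_partial (F l) i (F (l(i := Suc (l i))) x) x"
      using that l Suc.prems(2) unfolding partials_upto_def by blast
    then show ?thesis
      by (simp only: k[symmetric])
  qed
  from this[OF assms(1)] this[OF assms(2)] show ?case
    by (rule has_partial_unique) (use Suc.hyps(1)[OF n] l Suc.prems(2) in auto)
qed


section \<open>Shallow networks\<close>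

definition shallow :: "(real \<Rightarrow> real) \<Rightarrow> nat \<Rightarrow> (real ^ 'd \<Rightarrow> real) set" where
  "shallow \<sigma> M = {f. \<exists>(w :: nat \<Rightarrow> real ^ 'd) a b. f = (\<lambda>x. \<Sum>k=1..M. a k * \<sigma> (w k \<bullet> x + b k))}"


section \<open>Compositional functions with a binary tree\<close>

text \<open>Leaves carry the index of a variable, non-leaf vertices a label of type \<open>'h\<close>. Trees of type
  \<^typ>\<open>unit\<close> are the bare architectures; a choice of constituent functions is a tree labelled by
  functions.\<close>

datatype 'h btree = Leaf nat | Node 'h "'h btree" "'h btree"

abbreviation architecture :: "'h btree \<Rightarrow> unit btree" where
  "architecture t \<equiv> map_btree (\<lambda>_. ()) t"

fun leaves :: "'h btree \<Rightarrow> nat list" where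
  "leaves (Leaf i) = [i]"
| "leaves (Node _ l r) = leaves l @ leaves r"

fun num_nonleaf :: "'h btree \<Rightarrow> nat" where
  "num_nonleaf (Leaf _) = 0"
| "num_nonleaf (Node _ l r) = Suc (num_nonleaf l + num_nonleaf r)"

definition tree_on_vars :: "nat \<Rightarrow> unit btree \<Rightarrow> bool" where
  "tree_on_vars n T \<longleftrightarrow> distinct (leaves T) \<and> set (leaves T) = {1..n}"

fun compose :: "(real ^ 2 \<Rightarrow> real) btree \<Rightarrow> (nat \<Rightarrow> real) \<Rightarrow> real" where
  "compose (Leaf i) x = x i"
| "compose (Node h l r) x = h (vector [compose l x, compose r x])"

definition compositional :: "unit btree \<Rightarrow> (real ^ 2 \<Rightarrow> real) set \<Rightarrow> ((nat \<Rightarrow> real) \<Rightarrow> real) set" where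
  "compositional T H = {compose t | t. architecture t = T \<and> set_btree t \<subseteq> H}"

text \<open>A point of \<open>[-1,1]\<^sup>n\<close> is a sequence of which only the entries \<open>1, \<dots>, n\<close> matter.\<close>

definition ncube :: "nat \<Rightarrow> (nat \<Rightarrow> real) set" where
  "ncube n = {x. \<forall>i\<in>{1..n}. x i \<in> {-1..1}}"

definition W_comp :: "nat \<Rightarrow> nat \<Rightarrow> unit btree \<Rightarrow> ((nat \<Rightarrow> real) \<Rightarrow> real) set" where
  "W_comp m n T = {f. \<exists>g \<in> compositional T (W m). \<forall>x\<in>ncube n. f x = g x}"

definition deep :: "(real \<Rightarrow> real) \<Rightarrow> nat \<Rightarrow> unit btree \<Rightarrow> ((nat \<Rightarrow> real) \<Rightarrow> real) set" where
  "deep \<sigma> N T = {P. \<exists>M. N = num_nonleaf T * M \<and> P \<in> compositional T (shallow \<sigma> M)}"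

end

theory Submission
  imports Defs
begin

text \<open>Substituting \<open>x = cos \<theta>\<close>, \<open>y = cos \<phi>\<close> turns a constituent function into an even periodic function.
  Let \<open>J\<close> be convolution with the Fejer-Korovkin kernel of degree below \<open>N\<close>, whose first absolute
  moment is \<open>O(1/N)\<close>. Since \<open>I - J\<close> commutes with differentiation, \<open>(I - J)^m\<close> is \<open>O(N^-m)\<close> on
  functions with bounded derivative of order \<open>m\<close>, while \<open>I - (I - J)^m\<close> has polynomials in \<open>cos \<theta>\<close> of
  degree below \<open>N\<close> as values; applying it in both variables gives Jackson's theorem on the square.
  Polynomials of coordinate degree below \<open>N\<close> are limits of combinations of the \<open>N\<^sup>2\<close> units
  \<open>\<sigma> (t (i x + j y) + b)\<close>, \<open>i, j < N\<close>, as \<open>t \<rightarrow> 0\<close>, where no derivative of \<open>\<sigma>\<close> of order at most \<open>2 N\<close>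
  vanishes at \<open>b\<close>.

  The errors do not accumulate along the tree. For \<open>m \<ge> 2\<close> the normalisation of \<open>W m\<close> forces every
  constituent to be a contraction with constant \<open>4/5\<close>. For \<open>m = 1\<close> a constituent with Lipschitz
  constants \<open>L1, L2\<close> takes values of modulus at most \<open>1 - L1 - L2\<close>, so nodes that
  hardly contract have small range, and their parents are approximated on a small rectangle only.\<close>

section \<open>The Fejer-Korovkin kernel\<close>

text \<open>The constant must not depend on the tree, whose depth may be as large as n - 1. A bound
  of 1 on the sum of the Lipschitz constants alone would let the errors of the nodes add up along a
  branch, so each node has to absorb what it inherits. A second obstacle is that the output of one
  network feeds the next, which is controlled only on the square: every network must keep its values
  in [-1,1], although its target may reach the ends of that interval.

  With the number of units fixed, a network can come arbitrarily close to a given polynomial, at the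
  price of large outer coefficients, so the rate comes from Jackson's theorem alone. There a single
  nonnegative kernel saturates at order N^-2 however smooth the function is. Powers of the residual
  operator avoid this: each factor spends one derivative for one factor 1/N, and for that a first
  absolute moment is enough.\<close>

lemma has_integral_cos_int:
  fixes k :: int
  shows "((\<lambda>t. cos (of_int k * t)) has_integral (if k = 0 then 2 * pi else 0)) {-pi..pi}"
proof (cases "k = 0")
  case True
  then show ?thesis
    using has_integral_const_real[of "1::real" "-pi" pi] by simp
next
  case False
  have "((\<lambda>t. cos (of_int k * t)) has_integral
      sin (of_int k * pi) / of_int k - sin (of_int k * (-pi)) / of_int k) {-pi..pi}"
    using False
    by (intro fundamental_theorem_of_calculus)
      (auto simp: has_real_derivative_iff_has_vector_derivative[symmetric]
        intro!: derivative_eq_intros)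
  moreover have "sin (of_int k * pi) = 0"
    by (simp add: sin_times_pi_eq_0)
  ultimately show ?thesis
    using False by simp
qed

text \<open>Jordan's inequality for the sine, from concavity, taken at half the angle. It bounds the
  second moment of a kernel by its first cosine moment, which is explicit for the kernel
  below.\<close>

lemma one_minus_cos_ge:
  assumes "\<bar>t\<bar> \<le> pi"
  shows "1 - cos t \<ge> 2 / pi\<^sup>2 * t\<^sup>2"
proof -
  have *: "sin x \<ge> 2 / pi * x" if "0 \<le> x" "x \<le> pi / 2" for x
  proof -
    have "concave_on {0..pi} sin"
      by (rule f''_le0_imp_concave[where f' = cos and f'' = "\<lambda>x. - sin x"])
        (auto intro!: derivative_eq_intros sin_ge_zero)
    then have "sin ((1 - 2 * x / pi) *\<^sub>R 0 + (2 * x / pi) *\<^sub>R (pi / 2))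
        \<ge> (1 - 2 * x / pi) * sin 0 + (2 * x / pi) * sin (pi / 2)"
      using that by (intro concave_onD) (auto simp: field_simps)
    then show ?thesis by simp
  qed
  have "\<bar>t\<bar> / 2 \<ge> 0" "\<bar>t\<bar> / 2 \<le> pi / 2"
    using assms by auto
  from *[OF this] have "sin (\<bar>t\<bar> / 2) \<ge> \<bar>t\<bar> / pi"
    by simp
  then have "(sin (\<bar>t\<bar> / 2))\<^sup>2 \<ge> (\<bar>t\<bar> / pi)\<^sup>2"
    by (intro power_mono) auto
  moreover have "1 - cos t = 2 * (sin (\<bar>t\<bar> / 2))\<^sup>2"
    using cos_double_sin[of "\<bar>t\<bar> / 2"] by (simp add: abs_if split: if_splits)
  ultimately show ?thesis
    by (simp add: power_divide)
qed

text \<open>The top eigenvector of the adjacency matrix of a path, vanishing at j = 0 and j = N. It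
  maximises the sum of products of neighbours relative to the sum of squares, which makes the first
  cosine moment of the kernel as close to 1 as possible.\<close>

definition fk_coeff :: "nat \<Rightarrow> nat \<Rightarrow> real" where
  "fk_coeff N j = sin (real j * pi / real N)"

definition fk_norm :: "nat \<Rightarrow> real" where
  "fk_norm N = (\<Sum>j<N. (fk_coeff N j)\<^sup>2)"

text \<open>The squared modulus of the trigonometric polynomial with coefficients
  \<open>fk_coeff N j\<close>, in real form, hence nonnegative; the denominator gives it mass 1 on a
  period.\<close>

definition fk_kernel :: "nat \<Rightarrow> real \<Rightarrow> real" where
  "fk_kernel N t =
     ((\<Sum>j<N. fk_coeff N j * cos (real j * t))\<^sup>2 + (\<Sum>j<N. fk_coeff N j * sin (real j * t))\<^sup>2)
     / (2 * pi * fk_norm N)"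

lemma fk_norm_pos:
  assumes "N \<ge> 2"
  shows "fk_norm N > 0"
proof -
  have "fk_coeff N 1 > 0"
    unfolding fk_coeff_def using assms by (intro sin_gt_zero) (auto simp: field_simps)
  then show ?thesis
    unfolding fk_norm_def using assms by (intro sum_pos2[of _ 1]) auto
qed

lemma fk_kernel_nonneg: "fk_kernel N t \<ge> 0"
  unfolding fk_kernel_def fk_norm_def by (intro divide_nonneg_nonneg mult_nonneg_nonneg sum_nonneg add_nonneg_nonneg) auto

lemma continuous_on_fk_kernel [continuous_intros]:
  fixes f :: "'a::t2_space \<Rightarrow> real"
  shows "continuous_on A f \<Longrightarrow> continuous_on A (\<lambda>x. fk_kernel N (f x))"
  unfolding fk_kernel_def divide_inverse by (auto intro!: continuous_intros)

lemma fk_kernel_eq_sum: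
  "fk_kernel N t =
     (\<Sum>i<N. \<Sum>j<N. fk_coeff N i * fk_coeff N j / (2 * pi * fk_norm N) * cos (of_int (int i - int j) * t))"
  unfolding fk_kernel_def power2_eq_square
  by (simp add: sum_product cos_diff left_diff_distrib sum.distrib[symmetric] sum_divide_distrib
      algebra_simps add_divide_distrib)

lemma has_integral_fk_kernel:
  assumes "N \<ge> 2"
  shows "(fk_kernel N has_integral 1) {-pi..pi}"
proof -
  have "((\<lambda>t. \<Sum>i<N. \<Sum>j<N. fk_coeff N i * fk_coeff N j / (2 * pi * fk_norm N) * cos (of_int (int i - int j) * t))
    has_integral (\<Sum>i<N. \<Sum>j<N. fk_coeff N i * fk_coeff N j / (2 * pi * fk_norm N) * (if int i - int j = 0 then 2 * pi else 0)))
    {-pi..pi}"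
    by (intro has_integral_sum has_integral_mult_right has_integral_cos_int) auto
  moreover have "(\<Sum>i<N. \<Sum>j<N. fk_coeff N i * fk_coeff N j / (2 * pi * fk_norm N) * (if int i - int j = 0 then 2 * pi else 0))
    = (\<Sum>i<N. (fk_coeff N i)\<^sup>2 / fk_norm N)"
  proof (rule sum.cong[OF refl])
    fix i assume "i \<in> {..<N}"
    have "(\<Sum>j<N. fk_coeff N i * fk_coeff N j / (2 * pi * fk_norm N) * (if int i - int j = 0 then 2 * pi else 0))
      = (\<Sum>j<N. if i = j then (fk_coeff N i)\<^sup>2 / fk_norm N else 0)"
      by (intro sum.cong) (auto simp: power2_eq_square)
    then show "(\<Sum>j<N. fk_coeff N i * fk_coeff N j / (2 * pi * fk_norm N) * (if int i - int j = 0 then 2 * pi else 0))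
      = (fk_coeff N i)\<^sup>2 / fk_norm N"
      using \<open>i \<in> {..<N}\<close> by simp
  qed
  moreover have "\<dots> = 1"
    using fk_norm_pos[OF assms] by (simp add: sum_divide_distrib[symmetric] fk_norm_def)
  ultimately show ?thesis
    unfolding fk_kernel_eq_sum[abs_def] by simp
qed

text \<open>The eigenvector equation: two neighbours of an entry add up to 2 cos(pi/N) times that
  entry. Because the entries at 0 and N vanish, the sum over right neighbours equals the sum over
  left neighbours, and adding the two gives the claim doubled.\<close>

lemma fk_coeff_convolution:
  assumes "N \<ge> 2"
  shows "(\<Sum>i<N. fk_coeff N i * fk_coeff N (Suc i)) = cos (pi / N) * fk_norm N"
proof -
  obtain M where N: "N = Suc M"
    using assms by (cases N) auto
  have rec: "fk_coeff N (Suc (Suc i)) + fk_coeff N i = 2 * cos (pi / N) * fk_coeff N (Suc i)" for i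
  proof -
    have "fk_coeff N (Suc (Suc i)) = sin (real (Suc i) * pi / N + pi / N)"
      and "fk_coeff N i = sin (real (Suc i) * pi / N - pi / N)"
      using assms by (simp_all add: fk_coeff_def field_simps)
    then show ?thesis
      by (simp add: sin_add sin_diff fk_coeff_def)
  qed
  have zero: "fk_coeff N 0 = 0" "fk_coeff N N = 0"
    using assms by (auto simp: fk_coeff_def)
  have "(\<Sum>i<N. fk_coeff N i * fk_coeff N (Suc i))
      = (\<Sum>i<M. fk_coeff N (Suc i) * fk_coeff N (Suc (Suc i)))"
    unfolding N sum.lessThan_Suc_shift using zero by (simp add: N)
  moreover have "(\<Sum>i<N. fk_coeff N i * fk_coeff N (Suc i)) = (\<Sum>i<M. fk_coeff N (Suc i) * fk_coeff N i)"
    unfolding N sum.lessThan_Suc using zero by (simp add: N mult.commute)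
  ultimately have "2 * (\<Sum>i<N. fk_coeff N i * fk_coeff N (Suc i))
      = (\<Sum>i<M. fk_coeff N (Suc i) * fk_coeff N (Suc (Suc i))) + (\<Sum>i<M. fk_coeff N (Suc i) * fk_coeff N i)"
    by simp
  also have "\<dots> = (\<Sum>i<M. 2 * cos (pi / N) * (fk_coeff N (Suc i))\<^sup>2)"
    by (simp add: sum.distrib[symmetric] distrib_left[symmetric] rec power2_eq_square mult.left_commute)
  also have "\<dots> = 2 * cos (pi / N) * fk_norm N"
    unfolding fk_norm_def using zero by (simp add: N sum.lessThan_Suc_shift[of _ M] sum_distrib_left del: sum.lessThan_Suc)
  finally show ?thesis by simp
qed

text \<open>Multiplication by cos t shifts the frequency i - j by one, so only neighbouring pairs
  survive integration; they form the sum computed just before.\<close>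

lemma has_integral_fk_kernel_cos:
  assumes "N \<ge> 2"
  shows "((\<lambda>t. fk_kernel N t * cos t) has_integral cos (pi / N)) {-pi..pi}"
proof -
  let ?w = "\<lambda>i j. fk_coeff N i * fk_coeff N j / (2 * pi * fk_norm N)"
  have "((\<lambda>t. \<Sum>i<N. \<Sum>j<N. ?w i j * ((cos (of_int (int i - int j + 1) * t) + cos (of_int (int i - int j - 1) * t)) / 2))
    has_integral (\<Sum>i<N. \<Sum>j<N. ?w i j * (((if int i - int j + 1 = 0 then 2 * pi else 0) + (if int i - int j - 1 = 0 then 2 * pi else 0)) / 2)))
    {-pi..pi}"
    by (intro has_integral_sum has_integral_mult_right has_integral_divide has_integral_add has_integral_cos_int) auto
  moreover have "fk_kernel N t * cos t
      = (\<Sum>i<N. \<Sum>j<N. ?w i j * ((cos (of_int (int i - int j + 1) * t) + cos (of_int (int i - int j - 1) * t)) / 2))" for t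
    unfolding fk_kernel_eq_sum sum_distrib_right
    by (intro sum.cong refl)
      (simp add: distrib_right left_diff_distrib cos_add[of _ t] cos_diff[of _ t] mult.commute[of "cos t"])
  moreover have "(\<Sum>i<N. \<Sum>j<N. ?w i j * (((if int i - int j + 1 = 0 then 2 * pi else 0) + (if int i - int j - 1 = 0 then 2 * pi else 0)) / 2))
      = cos (pi / N)"
  proof -
    let ?e = "\<lambda>i j. if j = Suc i then ?w i j * pi else 0"
    have zero: "fk_coeff N N = 0"
      using assms by (auto simp: fk_coeff_def)
    have "(\<Sum>i<N. \<Sum>j<N. ?w i j * (((if int i - int j + 1 = 0 then 2 * pi else 0) + (if int i - int j - 1 = 0 then 2 * pi else 0)) / 2))
      = (\<Sum>i<N. \<Sum>j<N. ?e i j) + (\<Sum>i<N. \<Sum>j<N. ?e j i)"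
      unfolding sum.distrib[symmetric] by (intro sum.cong refl) (auto simp: mult.commute)
    also have "(\<Sum>i<N. \<Sum>j<N. ?e j i) = (\<Sum>i<N. \<Sum>j<N. ?e i j)"
      by (rule sum.swap)
    also have "(\<Sum>i<N. \<Sum>j<N. ?e i j) = (\<Sum>i<N. fk_coeff N i * fk_coeff N (Suc i) / (2 * fk_norm N))"
    proof (intro sum.cong refl)
      fix i assume "i \<in> {..<N}"
      then consider "Suc i < N" | "Suc i = N" by force
      then show "(\<Sum>j<N. ?e i j) = fk_coeff N i * fk_coeff N (Suc i) / (2 * fk_norm N)"
        by cases (auto simp: zero)
    qed
    also have "\<dots> = cos (pi / N) / 2"
      using fk_norm_pos[OF assms]
      by (simp add: sum_divide_distrib[symmetric] fk_coeff_convolution[OF assms])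
    finally show ?thesis by simp
  qed
  ultimately show ?thesis by simp
qed

text \<open>By the arithmetic-geometric mean inequality |t| is at most N t^2 / 2 + 1 / (2 N). The
  second moment is O(N^-2), since 1 - cos(pi/N) is. The constant 1 + pi^4 merely rounds up pi^4 / 8
  + 1 / 2.\<close>

lemma fk_kernel_first_moment:
  assumes "N \<ge> 2"
  shows "integral {-pi..pi} (\<lambda>t. \<bar>t\<bar> * fk_kernel N t) \<le> (1 + pi ^ 4) / N"
proof -
  let ?g = "\<lambda>t. N * pi\<^sup>2 / 4 * (fk_kernel N t - fk_kernel N t * cos t) + fk_kernel N t / (2 * N)"
  have g: "(?g has_integral N * pi\<^sup>2 / 4 * (1 - cos (pi / N)) + 1 / (2 * N)) {-pi..pi}"
    by (intro has_integral_add has_integral_mult_right has_integral_diff has_integral_divide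
        has_integral_fk_kernel has_integral_fk_kernel_cos assms)
  have "\<bar>t\<bar> * fk_kernel N t \<le> ?g t" if "t \<in> {-pi..pi}" for t
  proof -
    have "0 \<le> (N * \<bar>t\<bar> - 1)\<^sup>2" by simp
    then have "2 * N * \<bar>t\<bar> \<le> N\<^sup>2 * t\<^sup>2 + 1"
      by (simp add: power2_diff power_mult_distrib)
    then have "\<bar>t\<bar> \<le> N / 2 * t\<^sup>2 + 1 / (2 * N)"
      using assms by (simp add: field_simps power2_eq_square)
    also have "t\<^sup>2 \<le> pi\<^sup>2 / 2 * (1 - cos t)"
      using one_minus_cos_ge[of t] that by (simp add: field_simps abs_le_iff)
    finally have "\<bar>t\<bar> \<le> N / 2 * (pi\<^sup>2 / 2 * (1 - cos t)) + 1 / (2 * N)"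
      by (simp add: mult_left_mono)
    then have "\<bar>t\<bar> * fk_kernel N t \<le> (N / 2 * (pi\<^sup>2 / 2 * (1 - cos t)) + 1 / (2 * N)) * fk_kernel N t"
      by (intro mult_right_mono fk_kernel_nonneg)
    also have "\<dots> = ?g t"
      by (simp add: field_simps)
    finally show ?thesis .
  qed
  then have "integral {-pi..pi} (\<lambda>t. \<bar>t\<bar> * fk_kernel N t) \<le> integral {-pi..pi} ?g"
    using assms by (intro integral_le integrable_continuous_real continuous_intros) auto
  also have "\<dots> = N * pi\<^sup>2 / 4 * (1 - cos (pi / N)) + 1 / (2 * N)"
    using g by (rule integral_unique)
  also have "1 - cos (pi / N) \<le> (pi / N)\<^sup>2 / 2"
  proof -
    have "1 - cos (pi / N) = 2 * (sin (pi / N / 2))\<^sup>2"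
      using cos_double_sin[of "pi / N / 2"] by simp
    also have "(sin (pi / N / 2))\<^sup>2 \<le> (pi / N / 2)\<^sup>2"
      by (rule abs_le_square_iff[THEN iffD1]) (rule abs_sin_x_le_abs_x)
    finally show ?thesis by (simp add: power2_eq_square)
  qed
  then have "N * pi\<^sup>2 / 4 * (1 - cos (pi / N)) + 1 / (2 * N)
      \<le> N * pi\<^sup>2 / 4 * ((pi / N)\<^sup>2 / 2) + 1 / (2 * N)"
    by (intro add_right_mono mult_left_mono) auto
  also have "\<dots> = (pi ^ 4 / 8 + 1 / 2) / N"
    using assms by (simp add: field_simps power2_eq_square power4_eq_xxxx)
  also have "\<dots> \<le> (1 + pi ^ 4) / N"
  proof (rule divide_right_mono)
    have "(0::real) \<le> pi ^ 4" by simp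
    then show "pi ^ 4 / 8 + 1 / 2 \<le> 1 + pi ^ 4" by linarith
  qed simp
  finally show ?thesis .
qed

section \<open>Smoothing of periodic functions\<close>

text \<open>Convolution with the kernel; as the kernel is even, the sign of t is immaterial. With t
  as a shift of the argument, differentiation in \<theta> falls on F only.\<close>

definition smoothing :: "nat \<Rightarrow> (real \<Rightarrow> real) \<Rightarrow> real \<Rightarrow> real" where
  "smoothing N F \<theta> = integral {-pi..pi} (\<lambda>t. F (\<theta> + t) * fk_kernel N t)"

definition residual :: "nat \<Rightarrow> (real \<Rightarrow> real) \<Rightarrow> real \<Rightarrow> real" where
  "residual N F \<theta> = F \<theta> - smoothing N F \<theta>"

lemma continuous_on_UNIV_comp:
  fixes F :: "real \<Rightarrow> real"
  assumes "continuous_on UNIV F" "continuous_on A f"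
  shows "continuous_on A (\<lambda>x. F (f x))"
  using assms by (rule continuous_on_compose2) auto

lemma smoothing_integrable:
  assumes "continuous_on UNIV F"
  shows "(\<lambda>t. F (\<theta> + t) * fk_kernel N t) integrable_on {-pi..pi}"
  by (intro integrable_continuous_real continuous_intros continuous_on_UNIV_comp[OF assms])

lemma continuous_on_smoothing:
  assumes "continuous_on UNIV F"
  shows "continuous_on UNIV (smoothing N F)"
proof -
  have "continuous_on UNIV (\<lambda>\<theta>. integral (cbox (-pi) pi) (\<lambda>t. F (\<theta> + t) * fk_kernel N t))"
    by (rule integral_continuous_on_param)
      (auto simp: case_prod_unfold intro!: continuous_intros continuous_on_UNIV_comp[OF assms])
  then show ?thesis
    by (simp add: smoothing_def[abs_def])
qed

lemma continuous_on_residual: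
  assumes "continuous_on UNIV F"
  shows "continuous_on UNIV (residual N F)"
  unfolding residual_def[abs_def] by (intro continuous_intros assms continuous_on_smoothing)

lemma residual_power_Suc:
  "(residual N ^^ Suc r) F \<theta> = (residual N ^^ r) F \<theta> - smoothing N ((residual N ^^ r) F) \<theta>"
  by (simp only: funpow.simps comp_def residual_def[of N "(residual N ^^ r) F"])

lemma continuous_on_residual_power:
  assumes "continuous_on UNIV F"
  shows "continuous_on UNIV ((residual N ^^ r) F)"
  by (induction r) (auto intro: assms continuous_on_residual)

lemma smoothing_diff:
  assumes "continuous_on UNIV F" "continuous_on UNIV G"
  shows "smoothing N (\<lambda>x. F x - G x) \<theta> = smoothing N F \<theta> - smoothing N G \<theta>"
  unfolding smoothing_def left_diff_distrib
  by (intro integral_diff smoothing_integrable assms)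

lemma residual_power_diff:
  assumes "continuous_on UNIV F" "continuous_on UNIV G"
  shows "(residual N ^^ r) (\<lambda>x. F x - G x) \<theta> = (residual N ^^ r) F \<theta> - (residual N ^^ r) G \<theta>"
proof (induction r arbitrary: \<theta>)
  case (Suc r)
  then have "(residual N ^^ r) (\<lambda>x. F x - G x) = (\<lambda>x. (residual N ^^ r) F x - (residual N ^^ r) G x)"
    by auto
  then show ?case
    using assms by (simp only: residual_power_Suc) (simp add: smoothing_diff continuous_on_residual_power)
qed simp

lemma smoothing_bound:
  assumes "N \<ge> 2" "continuous_on UNIV F" "\<And>x. \<bar>F x\<bar> \<le> B"
  shows "\<bar>smoothing N F \<theta>\<bar> \<le> B"
proof -
  have "norm (smoothing N F \<theta>) \<le> integral {-pi..pi} (\<lambda>t. B * fk_kernel N t)"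
    unfolding smoothing_def
    by (rule integral_norm_bound_integral)
      (auto intro!: continuous_on_UNIV_comp[OF assms(2)] integrable_continuous_real continuous_intros mult_right_mono
        simp: abs_mult fk_kernel_nonneg assms(3))
  also have "\<dots> = B"
    using integral_unique[OF has_integral_mult_right[OF has_integral_fk_kernel[OF assms(1)], of B]]
    by (simp only: mult_1_right)
  finally show ?thesis by simp
qed

text \<open>Averaging does not increase the sup norm, so each factor at most doubles it. This serves
  for functions of which only the size is known.\<close>

lemma residual_power_bound:
  assumes "N \<ge> 2" "continuous_on UNIV F" "\<And>x. \<bar>F x\<bar> \<le> B"
  shows "\<bar>(residual N ^^ r) F \<theta>\<bar> \<le> 2 ^ r * B"
proof (induction r arbitrary: \<theta>)
  case (Suc r)
  have "\<bar>smoothing N ((residual N ^^ r) F) \<theta>\<bar> \<le> 2 ^ r * B"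
    by (intro smoothing_bound Suc continuous_on_residual_power assms)
  with Suc[of \<theta>] show ?case
    unfolding residual_power_Suc by simp
qed (simp add: assms)

text \<open>As the kernel has mass 1, the residual is the average of F \<theta> - F (\<theta> + t),
  which is at most B |t|; what remains is the first absolute moment.\<close>

lemma residual_Lipschitz_bound:
  assumes "N \<ge> 2" "\<And>x y. \<bar>F x - F y\<bar> \<le> B * \<bar>x - y\<bar>" and cont: "continuous_on UNIV F"
  shows "\<bar>residual N F \<theta>\<bar> \<le> B * ((1 + pi ^ 4) / N)"
proof -
  have "B \<ge> 0"
    using assms(2)[of 1 0] by simp
  have "((\<lambda>t. F \<theta> * fk_kernel N t) has_integral F \<theta> * 1) {-pi..pi}"
    by (intro has_integral_mult_right has_integral_fk_kernel assms)
  then have *: "integral {-pi..pi} (\<lambda>t. F \<theta> * fk_kernel N t) = F \<theta>"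
    by (simp only: integral_unique mult_1_right)
  have "residual N F \<theta> = integral {-pi..pi} (\<lambda>t. F \<theta> * fk_kernel N t - F (\<theta> + t) * fk_kernel N t)"
    unfolding residual_def smoothing_def
    by (subst integral_diff[OF _ smoothing_integrable[OF cont]])
      (auto simp only: * intro!: integrable_continuous_real continuous_intros)
  then have "residual N F \<theta> = integral {-pi..pi} (\<lambda>t. (F \<theta> - F (\<theta> + t)) * fk_kernel N t)"
    by (simp only: left_diff_distrib)
  moreover have "norm (integral {-pi..pi} (\<lambda>t. (F \<theta> - F (\<theta> + t)) * fk_kernel N t))
      \<le> integral {-pi..pi} (\<lambda>t. B * (\<bar>t\<bar> * fk_kernel N t))"
  proof (rule integral_norm_bound_integral)
    fix t assume "t \<in> {-pi..pi}"
    have "\<bar>F \<theta> - F (\<theta> + t)\<bar> \<le> B * \<bar>t\<bar>"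
      using assms(2)[of \<theta> "\<theta> + t"] by simp
    then have "\<bar>F \<theta> - F (\<theta> + t)\<bar> * fk_kernel N t \<le> B * \<bar>t\<bar> * fk_kernel N t"
      by (intro mult_right_mono fk_kernel_nonneg)
    then show "norm ((F \<theta> - F (\<theta> + t)) * fk_kernel N t) \<le> B * (\<bar>t\<bar> * fk_kernel N t)"
      by (simp add: abs_mult fk_kernel_nonneg mult.assoc)
  qed (intro integrable_continuous_real continuous_intros continuous_on_UNIV_comp[OF cont])+
  ultimately have "\<bar>residual N F \<theta>\<bar> \<le> B * integral {-pi..pi} (\<lambda>t. \<bar>t\<bar> * fk_kernel N t)"
    by simp
  also have "\<dots> \<le> B * ((1 + pi ^ 4) / N)"
    using \<open>B \<ge> 0\<close> by (intro mult_left_mono fk_kernel_first_moment assms)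
  finally show ?thesis .
qed

lemma smoothing_deriv:
  assumes "\<And>x. (F has_real_derivative F' x) (at x)" "continuous_on UNIV F'"
  shows "(smoothing N F has_real_derivative smoothing N F' \<theta>) (at \<theta>)"
proof -
  have cont: "continuous_on UNIV F"
    using assms(1) by (meson DERIV_continuous_on has_field_derivative_at_within)
  have "((\<lambda>\<theta>. integral (cbox (-pi) pi) (\<lambda>t. F (\<theta> + t) * fk_kernel N t)) has_field_derivative
      integral (cbox (-pi) pi) (\<lambda>t. F' (\<theta> + t) * fk_kernel N t)) (at \<theta> within UNIV)"
  proof (rule leibniz_rule_field_derivative)
    fix x t
    have "((\<lambda>x. F (x + t)) has_real_derivative F' (x + t)) (at x)"
      using assms(1)[of "x + t"] by (simp add: DERIV_shift)
    then show "((\<lambda>x. F (x + t) * fk_kernel N t) has_real_derivative F' (x + t) * fk_kernel N t) (at x within UNIV)"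
      by (auto intro!: DERIV_cmult_right)
  next
    show "continuous_on (UNIV \<times> cbox (-pi) pi) (\<lambda>(x, t). F' (x + t) * fk_kernel N t)"
      by (auto simp: case_prod_unfold intro!: continuous_intros continuous_on_UNIV_comp[OF assms(2)])
  qed (use smoothing_integrable[OF cont] in auto)
  then show ?thesis
    by (simp add: smoothing_def[abs_def])
qed

text \<open>Asking only for a Lipschitz bound on the derivative of order m lets level 0 cover
  functions that are known to be Lipschitz and nothing more.\<close>

fun lip_smooth :: "nat \<Rightarrow> real \<Rightarrow> (real \<Rightarrow> real) \<Rightarrow> bool" where
  "lip_smooth 0 B F \<longleftrightarrow> (\<forall>x y. \<bar>F x - F y\<bar> \<le> B * \<bar>x - y\<bar>)"
| "lip_smooth (Suc m) B F \<longleftrightarrow> (\<exists>F'. (\<forall>x. (F has_real_derivative F' x) (at x)) \<and> lip_smooth m B F')"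

lemma lip_smooth_continuous: "lip_smooth m B F \<Longrightarrow> continuous_on UNIV F"
proof (induction m arbitrary: F)
  case 0
  then have "B-lipschitz_on UNIV F"
    using 0[simplified, rule_format, of 1 0] by (auto simp: lipschitz_on_def dist_real_def)
  then show ?case
    by (rule lipschitz_on_continuous_on)
next
  case (Suc m)
  then show ?case
    by (metis DERIV_continuous_on has_field_derivative_at_within lip_smooth.simps(2))
qed

text \<open>The trade of one derivative for a factor 1/N. The residual commutes with
  differentiation, and when only one derivative is left, a small residual of F' is a small Lipschitz
  constant for the residual of F.\<close>

lemma lip_smooth_residual:
  assumes "N \<ge> 2"
  shows "lip_smooth (Suc m) B F \<Longrightarrow> lip_smooth m (B * ((1 + pi ^ 4) / N)) (residual N F)"
proof (induction m arbitrary: F)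
  case 0
  then obtain F' where F': "\<And>x. (F has_real_derivative F' x) (at x)" and lip: "lip_smooth 0 B F'"
    by auto
  have cont: "continuous_on UNIV F'"
    using lip by (rule lip_smooth_continuous)
  have "(residual N F has_real_derivative residual N F' x) (at x)" for x
    unfolding residual_def[abs_def] by (intro derivative_intros F' smoothing_deriv cont)
  moreover have "\<bar>residual N F' x\<bar> \<le> B * ((1 + pi ^ 4) / N)" for x
    using lip by (intro residual_Lipschitz_bound assms cont) auto
  ultimately have "norm (residual N F x - residual N F y) \<le> B * ((1 + pi ^ 4) / N) * norm (x - y)" for x y
    by (intro field_differentiable_bound[of UNIV]) auto
  then show ?case
    by simp
next
  case (Suc m)
  then obtain F' where F': "\<And>x. (F has_real_derivative F' x) (at x)" and lip: "lip_smooth (Suc m) B F'"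
    by auto
  have "(residual N F has_real_derivative residual N F' x) (at x)" for x
    unfolding residual_def[abs_def]
    by (intro derivative_intros F' smoothing_deriv lip_smooth_continuous[OF lip])
  then show ?case
    using Suc.IH[OF lip] by auto
qed

text \<open>Each of the first m factors uses up one derivative, and the last one acts on a function
  that is merely Lipschitz; hence the power \<open>Suc m\<close>.\<close>

lemma residual_power_smooth_bound:
  assumes "N \<ge> 2"
  shows "lip_smooth m B F \<Longrightarrow> \<bar>(residual N ^^ Suc m) F \<theta>\<bar> \<le> B * ((1 + pi ^ 4) / N) ^ Suc m"
proof (induction m arbitrary: F B)
  case 0
  then show ?case
    using residual_Lipschitz_bound[OF assms, of F B \<theta>] lip_smooth_continuous[OF 0] by simp
next
  case (Suc m)
  from Suc.IH[OF lip_smooth_residual[OF assms Suc.prems]] show ?case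
    by (simp add: funpow_swap1 mult.assoc)
qed

text \<open>With an antiderivative G the shifted integral is G (u + pi) - G (u - pi), whose
  derivative in the shift u is F (u + pi) - F (u - pi) = 0.\<close>

lemma integral_periodic_shift:
  fixes F :: "real \<Rightarrow> real"
  assumes cont: "continuous_on UNIV F" and per: "\<And>x. F (x + 2 * pi) = F x"
  shows "integral {-pi..pi} (\<lambda>t. F (\<theta> + t)) = integral {-pi..pi} F"
proof -
  define \<Phi> where "\<Phi> u = integral {-pi..pi} (\<lambda>t. F (u + t))" for u
  have ex: "\<exists>G. \<forall>x\<in>{a..b}. (G has_real_derivative F x) (at x within {a..b})" for a b
  proof (cases "a \<le> b")
    case True
    then show ?thesis
      using antiderivative_continuous[of a b F] continuous_on_subset[OF cont]
      by (metis has_real_derivative_iff_has_vector_derivative subset_UNIV)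
  qed auto
  \<comment> \<open>The extra 1 keeps all arguments in the open interval, so that the derivative of
    G there is two-sided.\<close>
  define R where "R = \<bar>\<theta>\<bar> + pi + 1"
  from ex obtain G where G: "\<And>x. x \<in> {-R..R} \<Longrightarrow> (G has_real_derivative F x) (at x within {-R..R})"
    by meson
  have R: "u + t \<in> {-R<..<R}" if "\<bar>u\<bar> \<le> \<bar>\<theta>\<bar>" "t \<in> {-pi..pi}" for u t
    using that by (auto simp: R_def abs_if split: if_splits)
  have G': "(G has_real_derivative F x) (at x)" if "x \<in> {-R<..<R}" for x
  proof -
    have "x \<in> interior {-R..R}" "x \<in> {-R..R}"
      using that by auto
    then show ?thesis
      using G[of x] by (metis at_within_interior)
  qed
  have \<Phi>: "\<Phi> u = G (u + pi) - G (u - pi)" if "\<bar>u\<bar> \<le> \<bar>\<theta>\<bar>" for u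
  proof -
    have "((\<lambda>t. F (u + t)) has_integral G (u + pi) - G (u + -pi)) {-pi..pi}"
    proof (rule fundamental_theorem_of_calculus)
      fix t assume "t \<in> {-pi..pi}"
      then have "(G has_real_derivative F (t + u)) (at (t + u))"
        using G'[OF R[OF that]] by (simp only: add.commute)
      then have "((\<lambda>t. G (u + t)) has_real_derivative F (u + t)) (at t)"
        by (simp only: DERIV_shift add.commute)
      then show "((\<lambda>t. G (u + t)) has_vector_derivative F (u + t)) (at t within {-pi..pi})"
        by (simp add: has_real_derivative_iff_has_vector_derivative has_vector_derivative_at_within)
    qed simp
    then show ?thesis
      unfolding \<Phi>_def by (simp add: integral_unique)
  qed
  have "((\<lambda>u. G (u + pi) - G (u - pi)) has_real_derivative 0) (at u within {-\<bar>\<theta>\<bar>..\<bar>\<theta>\<bar>})"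
    if "u \<in> {-\<bar>\<theta>\<bar>..\<bar>\<theta>\<bar>}" for u
  proof -
    have u: "\<bar>u\<bar> \<le> \<bar>\<theta>\<bar>" using that by auto
    have "((\<lambda>u. G (u + pi)) has_real_derivative F (u + pi)) (at u)"
      "((\<lambda>u. G (u + - pi)) has_real_derivative F (u + - pi)) (at u)"
      unfolding DERIV_shift[symmetric] by (rule G'[OF R[OF u]]; simp)+
    moreover have "F (u + pi) = F (u + - pi)"
      using per[of "u - pi"] by (simp add: algebra_simps)
    ultimately have "((\<lambda>u. G (u + pi) - G (u + - pi)) has_real_derivative 0) (at u)"
      using DERIV_diff by fastforce
    then show ?thesis
      by (simp add: has_field_derivative_at_within)
  qed
  then have "norm ((G (\<theta> + pi) - G (\<theta> - pi)) - (G (0 + pi) - G (0 - pi))) \<le> 0 * norm (\<theta> - 0)"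
    by (intro field_differentiable_bound[of "{-\<bar>\<theta>\<bar>..\<bar>\<theta>\<bar>}"]) auto
  then have "\<Phi> \<theta> = \<Phi> 0"
    using \<Phi>[of \<theta>] \<Phi>[of 0] by simp
  then show ?thesis
    by (simp add: \<Phi>_def)
qed

section \<open>Jackson's theorem in two variables\<close>

text \<open>The properties that composition with the cosine enforces. Evenness removes the sine
  terms of a convolution, so that its values are polynomials in cos \<theta>.\<close>

definition even_periodic :: "(real \<Rightarrow> real) \<Rightarrow> bool" where
  "even_periodic F \<longleftrightarrow> continuous_on UNIV F \<and> (\<forall>x. F (- x) = F x) \<and> (\<forall>x. F (x + 2 * pi) = F x)"

text \<open>The Chebyshev polynomials of the first kind, by their three-term recurrence.\<close>

lemma cos_multiple_poly:
  "\<exists>p :: real poly. degree p \<le> n \<and> (\<forall>\<theta>. cos (real n * \<theta>) = poly p (cos \<theta>))"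
proof (induction n rule: less_induct)
  case (less n)
  consider "n = 0" | "n = 1" | k where "n = Suc (Suc k)"
    by (metis One_nat_def not0_implies_Suc)
  then show ?case
  proof cases
    case 1
    then show ?thesis by (intro exI[of _ 1]) auto
  next
    case 2
    then show ?thesis by (intro exI[of _ "[:0, 1:]"]) auto
  next
    case 3
    obtain p q where p: "degree p \<le> Suc k" "\<And>\<theta>. cos (real (Suc k) * \<theta>) = poly p (cos \<theta>)"
      and q: "degree q \<le> k" "\<And>\<theta>. cos (real k * \<theta>) = poly q (cos \<theta>)"
      using less[of "Suc k"] less[of k] 3 by auto
    have "cos (real n * \<theta>) = 2 * cos \<theta> * cos (real (Suc k) * \<theta>) - cos (real k * \<theta>)" for \<theta>
    proof -
      have "cos (real n * \<theta>) = cos (real (Suc k) * \<theta> + \<theta>)" "cos (real k * \<theta>) = cos (real (Suc k) * \<theta> - \<theta>)"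
        using 3 by (simp_all add: algebra_simps)
      then show ?thesis
        unfolding cos_add cos_diff by simp
    qed
    then have "cos (real n * \<theta>) = poly ([:0, 2:] * p - q) (cos \<theta>)" for \<theta>
      by (simp add: p(2) q(2) del: of_nat_Suc)
    moreover have "degree ([:0, 2:] * p - q) \<le> n"
    proof (rule degree_diff_le)
      have "degree ([:0, 2:] * p) \<le> degree [:0, 2::real:] + degree p"
        by (rule degree_mult_le)
      then show "degree ([:0, 2:] * p) \<le> n"
        using p(1) 3 by simp
    qed (use q 3 in simp)
    ultimately show ?thesis by blast
  qed
qed

lemma cos_multiple_expansion:
  obtains \<tau> :: "nat \<Rightarrow> nat \<Rightarrow> real"
  where "\<And>n \<theta>. n < N \<Longrightarrow> cos (real n * \<theta>) = (\<Sum>k<N. \<tau> n k * cos \<theta> ^ k)"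
proof -
  obtain p :: "nat \<Rightarrow> real poly" where p: "\<And>n. degree (p n) \<le> n"
      "\<And>n \<theta>. cos (real n * \<theta>) = poly (p n) (cos \<theta>)"
    using cos_multiple_poly by metis
  have "cos (real n * \<theta>) = (\<Sum>k<N. coeff (p n) k * cos \<theta> ^ k)" if "n < N" for n \<theta>
  proof -
    have "cos (real n * \<theta>) = (\<Sum>k\<le>degree (p n). coeff (p n) k * cos \<theta> ^ k)"
      by (simp add: p(2) poly_altdef)
    also have "\<dots> = (\<Sum>k<N. coeff (p n) k * cos \<theta> ^ k)"
      using p(1)[of n] that by (intro sum.mono_neutral_left) (auto simp: coeff_eq_0)
    finally show ?thesis .
  qed
  then show ?thesis
    using that[of "\<lambda>n. coeff (p n)"] by blast
qed

lemma fk_kernel_periodic: "fk_kernel N (t + 2 * pi) = fk_kernel N t"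
proof -
  have "cos (real j * (t + 2 * pi)) = cos (real j * t)" "sin (real j * (t + 2 * pi)) = sin (real j * t)" for j
    using sin_cos_eq_iff[of "real j * (t + 2 * pi)" "real j * t"]
    by (auto intro!: exI[of _ "int j"] simp: algebra_simps)
  then show ?thesis
    by (simp add: fk_kernel_def)
qed

lemma smoothing_eq_convolution:
  assumes "even_periodic F"
  shows "smoothing N F \<theta> = integral {-pi..pi} (\<lambda>s. F s * fk_kernel N (s - \<theta>))"
proof -
  have cont: "continuous_on UNIV F" and per: "\<And>x. F (x + 2 * pi) = F x"
    using assms by (auto simp: even_periodic_def)
  have "fk_kernel N (x + 2 * pi - \<theta>) = fk_kernel N (x - \<theta>)" for x
    using fk_kernel_periodic[of N "x - \<theta>"] by (simp add: algebra_simps)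
  then have "integral {-pi..pi} (\<lambda>t. (\<lambda>s. F s * fk_kernel N (s - \<theta>)) (\<theta> + t))
      = integral {-pi..pi} (\<lambda>s. F s * fk_kernel N (s - \<theta>))"
    by (intro integral_periodic_shift continuous_intros cont) (simp add: per)
  then show ?thesis
    by (simp add: smoothing_def)
qed

text \<open>The coefficients are integrals against fixed continuous weights, the same for all F. So
  the formula may be applied to a function with a parameter, and its coefficients are then
  continuous, even and periodic in that parameter. All frequencies i - j have modulus below N, which
  bounds the degree in cos \<theta>.\<close>

lemma smoothing_representation:
  obtains w :: "nat \<Rightarrow> real \<Rightarrow> real" where "\<And>k. continuous_on UNIV (w k)"
    and "\<And>F \<theta>. even_periodic F \<Longrightarrow>
      smoothing N F \<theta> = (\<Sum>k<N. cos \<theta> ^ k * integral {-pi..pi} (\<lambda>s. F s * w k s))"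
proof -
  obtain \<tau> where \<tau>: "\<And>n \<theta>. n < N \<Longrightarrow> cos (real n * \<theta>) = (\<Sum>k<N. \<tau> n k * cos \<theta> ^ k)"
    using cos_multiple_expansion[of N] by blast
  define c where "c i j = fk_coeff N i * fk_coeff N j / (2 * pi * fk_norm N)" for i j
  define d where "d i j = int i - int j" for i j
  define w where "w k s = (\<Sum>i<N. \<Sum>j<N. c i j * \<tau> (nat \<bar>d i j\<bar>) k * cos (of_int (d i j) * s))" for k s
  have "continuous_on UNIV (w k)" for k
    unfolding w_def by (intro continuous_intros)
  moreover have "smoothing N F \<theta> = (\<Sum>k<N. cos \<theta> ^ k * integral {-pi..pi} (\<lambda>s. F s * w k s))"
    if F: "even_periodic F" for F \<theta>
  proof -
    have cont: "continuous_on A F" for A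
      using F continuous_on_subset by (auto simp: even_periodic_def)
    define C where "C i j = integral {-pi..pi} (\<lambda>s. F s * cos (of_int (d i j) * s))" for i j
    have C: "((\<lambda>s. F s * cos (of_int (d i j) * s)) has_integral C i j) {-pi..pi}" for i j
      unfolding C_def by (intro integrable_integral integrable_continuous_real continuous_intros cont)
    \<comment> \<open>The integrand is odd: reflection turns the integral into its own
      negative.\<close>
    have S: "((\<lambda>s. F s * sin (of_int k * s)) has_integral 0) {-pi..pi}" for k :: int
    proof -
      let ?g = "\<lambda>s. F s * sin (of_int k * s)"
      have "integral {-pi..pi} (\<lambda>s. ?g (- s)) = integral {-pi..pi} ?g"
        using Henstock_Kurzweil_Integration.integral_reflect_real[of pi "-pi" ?g] by simp
      then have "integral {-pi..pi} ?g = 0"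
        using F by (simp add: even_periodic_def)
      moreover have "?g integrable_on {-pi..pi}"
        by (intro integrable_continuous_real continuous_intros cont)
      ultimately show ?thesis
        using integrable_integral by fastforce
    qed
    have cosd: "cos (of_int (d i j) * \<theta>) = (\<Sum>k<N. \<tau> (nat \<bar>d i j\<bar>) k * cos \<theta> ^ k)"
      if "i < N" "j < N" for i j
    proof -
      have "cos (of_int (d i j) * \<theta>) = cos (real (nat \<bar>d i j\<bar>) * \<theta>)"
        by (cases "d i j \<ge> 0") (auto simp: abs_if)
      moreover have "nat \<bar>d i j\<bar> < N"
        using that by (auto simp: d_def)
      ultimately show ?thesis using \<tau> by metis
    qed
    have "((\<lambda>s. \<Sum>i<N. \<Sum>j<N. c i j * (cos (of_int (d i j) * \<theta>) * (F s * cos (of_int (d i j) * s))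
          + sin (of_int (d i j) * \<theta>) * (F s * sin (of_int (d i j) * s))))
        has_integral (\<Sum>i<N. \<Sum>j<N. c i j * (cos (of_int (d i j) * \<theta>) * C i j + sin (of_int (d i j) * \<theta>) * 0)))
        {-pi..pi}"
      by (intro has_integral_sum has_integral_mult_right has_integral_add C S) auto
    moreover have "F s * fk_kernel N (s - \<theta>) = (\<Sum>i<N. \<Sum>j<N. c i j * (cos (of_int (d i j) * \<theta>) * (F s * cos (of_int (d i j) * s))
          + sin (of_int (d i j) * \<theta>) * (F s * sin (of_int (d i j) * s))))" for s
      unfolding fk_kernel_eq_sum sum_distrib_left c_def d_def
      by (intro sum.cong refl) (simp only: right_diff_distrib cos_diff, simp add: algebra_simps)
    ultimately have "smoothing N F \<theta> = (\<Sum>i<N. \<Sum>j<N. c i j * (cos (of_int (d i j) * \<theta>) * C i j))"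
      unfolding smoothing_eq_convolution[OF F] by (simp add: integral_unique)
    also have "\<dots> = (\<Sum>i<N. \<Sum>j<N. \<Sum>k<N. cos \<theta> ^ k * (c i j * \<tau> (nat \<bar>d i j\<bar>) k * C i j))"
    proof (intro sum.cong refl)
      fix i j assume "i \<in> {..<N}" "j \<in> {..<N}"
      then show "c i j * (cos (of_int (d i j) * \<theta>) * C i j)
          = (\<Sum>k<N. cos \<theta> ^ k * (c i j * \<tau> (nat \<bar>d i j\<bar>) k * C i j))"
        by (simp add: cosd sum_distrib_left sum_distrib_right) (simp add: mult_ac)
    qed
    also have "\<dots> = (\<Sum>i<N. \<Sum>k<N. \<Sum>j<N. cos \<theta> ^ k * (c i j * \<tau> (nat \<bar>d i j\<bar>) k * C i j))"
      by (rule sum.cong[OF refl]) (rule sum.swap)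
    also have "\<dots> = (\<Sum>k<N. \<Sum>i<N. \<Sum>j<N. cos \<theta> ^ k * (c i j * \<tau> (nat \<bar>d i j\<bar>) k * C i j))"
      by (rule sum.swap)
    also have "\<dots> = (\<Sum>k<N. cos \<theta> ^ k * integral {-pi..pi} (\<lambda>s. F s * w k s))"
    proof (intro sum.cong refl)
      fix k
      have "((\<lambda>s. \<Sum>i<N. \<Sum>j<N. c i j * \<tau> (nat \<bar>d i j\<bar>) k * (F s * cos (of_int (d i j) * s))) has_integral
        (\<Sum>i<N. \<Sum>j<N. c i j * \<tau> (nat \<bar>d i j\<bar>) k * C i j)) {-pi..pi}"
        by (intro has_integral_sum has_integral_mult_right C) auto
      moreover have "F s * w k s = (\<Sum>i<N. \<Sum>j<N. c i j * \<tau> (nat \<bar>d i j\<bar>) k * (F s * cos (of_int (d i j) * s)))" for s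
        unfolding w_def sum_distrib_left by (intro sum.cong refl) simp
      ultimately have "integral {-pi..pi} (\<lambda>s. F s * w k s) = (\<Sum>i<N. \<Sum>j<N. c i j * \<tau> (nat \<bar>d i j\<bar>) k * C i j)"
        by (simp add: integral_unique)
      then show "(\<Sum>i<N. \<Sum>j<N. cos \<theta> ^ k * (c i j * \<tau> (nat \<bar>d i j\<bar>) k * C i j))
          = cos \<theta> ^ k * integral {-pi..pi} (\<lambda>s. F s * w k s)"
        by (simp add: sum_distrib_left)
    qed
    finally show ?thesis .
  qed
  ultimately show ?thesis using that by blast
qed

text \<open>With R = I - J one has I - R^(r+1) = (I - R^r) + J R^r. By induction R^r F is F minus a
  polynomial in the cosine, hence again even and periodic, and the representation of J applies to
  it.\<close>

lemma residual_power_representation: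
  "\<exists>w. (\<forall>k. continuous_on UNIV (w k)) \<and> (\<forall>F \<theta>. even_periodic F \<longrightarrow>
    F \<theta> - (residual N ^^ r) F \<theta> = (\<Sum>k<N. cos \<theta> ^ k * integral {-pi..pi} (\<lambda>s. F s * w k s)))"
proof (induction r)
  case 0
  show ?case
    by (rule exI[of _ "\<lambda>_ _. 0"]) auto
next
  case (Suc r)
  then obtain w where w: "\<And>k. continuous_on UNIV (w k)"
      "\<And>F \<theta>. even_periodic F \<Longrightarrow>
        F \<theta> - (residual N ^^ r) F \<theta> = (\<Sum>k<N. cos \<theta> ^ k * integral {-pi..pi} (\<lambda>s. F s * w k s))"
    by blast
  obtain v :: "nat \<Rightarrow> real \<Rightarrow> real" where v: "\<And>k. continuous_on UNIV (v k)"
    "\<And>F \<theta>. even_periodic F \<Longrightarrow>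
      smoothing N F \<theta> = (\<Sum>k<N. cos \<theta> ^ k * integral {-pi..pi} (\<lambda>s. F s * v k s))"
    using smoothing_representation[of N] by blast
  \<comment> \<open>The functionals of J evaluated at the powers of the cosine. They are needed
    because J acts on F minus a cosine polynomial whose coefficients are the integrals of F against
    w; \<open>u\<close> collects the resulting weights on F.\<close>
  define \<gamma> where "\<gamma> k l = integral {-pi..pi} (\<lambda>s. cos s ^ l * v k s)" for k l
  define u where "u k s = w k s + (v k s - (\<Sum>l<N. \<gamma> k l * w l s))" for k s
  have wc: "continuous_on A (w k)" "continuous_on A (v k)" for A k
    using w(1) v(1) continuous_on_subset by blast+
  have "F \<theta> - (residual N ^^ Suc r) F \<theta> = (\<Sum>k<N. cos \<theta> ^ k * integral {-pi..pi} (\<lambda>s. F s * u k s))"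
    if F: "even_periodic F" for F \<theta>
  proof -
    have cont: "continuous_on A F" for A
      using F continuous_on_subset by (auto simp: even_periodic_def)
    define L where "L k = integral {-pi..pi} (\<lambda>s. F s * w k s)" for k
    define M where "M k = integral {-pi..pi} (\<lambda>s. F s * v k s)" for k
    have L: "((\<lambda>s. F s * w k s) has_integral L k) {-pi..pi}" for k
      unfolding L_def by (intro integrable_integral integrable_continuous_real continuous_intros cont wc)
    have M: "((\<lambda>s. F s * v k s) has_integral M k) {-pi..pi}" for k
      unfolding M_def by (intro integrable_integral integrable_continuous_real continuous_intros cont wc)
    have \<gamma>: "((\<lambda>s. cos s ^ l * v k s) has_integral \<gamma> k l) {-pi..pi}" for k l
      unfolding \<gamma>_def by (intro integrable_integral integrable_continuous_real continuous_intros wc)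
    define G where "G = (residual N ^^ r) F"
    have G: "G s = F s - (\<Sum>k<N. cos s ^ k * L k)" for s
      using w(2)[OF F, of s] by (simp add: L_def G_def algebra_simps)
    have "even_periodic G"
      using F by (auto simp: even_periodic_def G intro!: continuous_intros cont)
    then have "smoothing N G \<theta> = (\<Sum>k<N. cos \<theta> ^ k * integral {-pi..pi} (\<lambda>s. G s * v k s))"
      by (rule v(2))
    moreover have "integral {-pi..pi} (\<lambda>s. G s * v k s) = M k - (\<Sum>l<N. L l * \<gamma> k l)" for k
    proof (rule integral_unique)
      have "((\<lambda>s. F s * v k s - (\<Sum>l<N. L l * (cos s ^ l * v k s))) has_integral (M k - (\<Sum>l<N. L l * \<gamma> k l))) {-pi..pi}"
        by (intro has_integral_diff has_integral_sum has_integral_mult_right M \<gamma>) auto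
      moreover have "G s * v k s = F s * v k s - (\<Sum>l<N. L l * (cos s ^ l * v k s))" for s
        by (simp add: G left_diff_distrib sum_distrib_right mult.assoc mult.left_commute[of _ "L _"])
      ultimately show "((\<lambda>s. G s * v k s) has_integral (M k - (\<Sum>l<N. L l * \<gamma> k l))) {-pi..pi}"
        by simp
    qed
    ultimately have sG: "smoothing N G \<theta> = (\<Sum>k<N. cos \<theta> ^ k * (M k - (\<Sum>l<N. L l * \<gamma> k l)))"
      by simp
    have "integral {-pi..pi} (\<lambda>s. F s * u k s) = L k + (M k - (\<Sum>l<N. L l * \<gamma> k l))" for k
    proof (rule integral_unique)
      have "((\<lambda>s. F s * w k s + (F s * v k s - (\<Sum>l<N. \<gamma> k l * (F s * w l s))))
        has_integral (L k + (M k - (\<Sum>l<N. \<gamma> k l * L l)))) {-pi..pi}"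
        by (intro has_integral_add has_integral_diff has_integral_sum has_integral_mult_right L M) auto
      moreover have "F s * u k s = F s * w k s + (F s * v k s - (\<Sum>l<N. \<gamma> k l * (F s * w l s)))" for s
        by (simp add: u_def distrib_left right_diff_distrib sum_distrib_left mult.left_commute)
      ultimately show "((\<lambda>s. F s * u k s) has_integral (L k + (M k - (\<Sum>l<N. L l * \<gamma> k l)))) {-pi..pi}"
        by (simp add: mult.commute[of _ "\<gamma> _ _"])
    qed
    moreover have "F \<theta> - (residual N ^^ Suc r) F \<theta> = (F \<theta> - G \<theta>) + smoothing N G \<theta>"
      by (simp only: residual_power_Suc G_def)
    ultimately show ?thesis
      by (simp add: sG G distrib_left sum.distrib)
  qed
  moreover have "continuous_on UNIV (u k)" for k
    unfolding u_def by (intro continuous_intros wc)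
  ultimately show ?case by blast
qed

text \<open>Let Rx and Ry be the residual powers in the two variables and U = H - Ry H. The
  approximant is U - Rx U, and its error is Rx H + Ry H - Rx (Ry H). The first two terms are small
  by smoothness in x and in y separately; the third is bounded by the size of Ry H times 2 per
  factor of Rx, which produces the constant 1 + 2^(m+1).\<close>

lemma jackson_trigonometric_two_variables:
  fixes H :: "real \<Rightarrow> real \<Rightarrow> real"
  assumes N: "N \<ge> 2"
    and cont: "continuous_on UNIV (\<lambda>(x, y). H x y)"
    and per: "\<And>y. even_periodic (\<lambda>x. H x y)" "\<And>x. even_periodic (H x)"
    and smooth: "\<And>y. lip_smooth m B1 (\<lambda>x. H x y)" "\<And>x. lip_smooth m B2 (H x)"
    and B: "B1 \<ge> 0" "B2 \<ge> 0"
  shows "\<exists>c. \<forall>x y. \<bar>H x y - (\<Sum>k<N. \<Sum>l<N. c k l * cos x ^ k * cos y ^ l)\<bar>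
    \<le> (1 + 2 ^ Suc m) * (1 + pi ^ 4) ^ Suc m * (B1 + B2) / N ^ Suc m"
proof -
  let ?R = "residual N ^^ Suc m"
  define \<omega> where "\<omega> = ((1 + pi ^ 4) / N) ^ Suc m"
  have "\<omega> \<ge> 0"
    unfolding \<omega>_def by (intro zero_le_power divide_nonneg_nonneg add_nonneg_nonneg) auto
  obtain w where w: "\<And>k. continuous_on UNIV (w k)"
      "\<And>F \<theta>. even_periodic F \<Longrightarrow>
        F \<theta> - ?R F \<theta> = (\<Sum>k<N. cos \<theta> ^ k * integral {-pi..pi} (\<lambda>s. F s * w k s))"
    using residual_power_representation[where N = N and r = "Suc m"] by blast
  have wc: "continuous_on A (w k)" for A k
    by (rule continuous_on_subset[OF w(1)]) simp
  define c where "c l x = integral {-pi..pi} (\<lambda>s. H x s * w l s)" for l x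
  \<comment> \<open>The arguments are swapped so that \<open>U y\<close> is the function of x on
    which the operator in the first variable acts.\<close>
  define U where "U y x = (\<Sum>l<N. cos y ^ l * c l x)" for y x
  have c_cont: "continuous_on A (c l)" for A l
  proof -
    have "continuous_on UNIV (\<lambda>x. integral (cbox (-pi) pi) (\<lambda>s. H x s * w l s))"
    proof (rule integral_continuous_on_param)
      have "continuous_on (UNIV \<times> cbox (-pi) pi) (\<lambda>(x, s). H x s)"
        by (rule continuous_on_subset[OF cont]) simp
      moreover have "continuous_on (UNIV \<times> cbox (-pi) pi) (\<lambda>p::real \<times> real. w l (snd p))"
        by (rule continuous_on_UNIV_comp[OF w(1) continuous_on_snd[OF continuous_on_id]])
      ultimately show "continuous_on (UNIV \<times> cbox (-pi) pi) (\<lambda>(x, s). H x s * w l s)"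
        using continuous_on_mult by (force simp: case_prod_unfold)
    qed
    then show ?thesis
      unfolding c_def[abs_def] using continuous_on_subset by auto
  qed
  have c_sym: "c l (- x) = c l x" "c l (x + 2 * pi) = c l x" for l x
    using per(1) by (simp_all add: c_def even_periodic_def)
  have U_good: "even_periodic (U y)" for y
    unfolding even_periodic_def U_def by (auto intro!: continuous_intros c_cont simp: c_sym)
  have U: "H x y - U y x = ?R (H x) y" for x y
    using w(2)[OF per(2), of x y] by (simp add: U_def c_def)
  have Hc: "continuous_on UNIV (\<lambda>x. H x y)" for y
    using per(1) by (auto simp: even_periodic_def)
  have Uc: "continuous_on UNIV (U y)" for y
    using U_good by (auto simp: even_periodic_def)
  define a where "a k l = integral {-pi..pi} (\<lambda>s. c l s * w k s)" for k l
  have "\<bar>H x y - (\<Sum>k<N. \<Sum>l<N. a k l * cos x ^ k * cos y ^ l)\<bar>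
    \<le> (1 + 2 ^ Suc m) * (1 + pi ^ 4) ^ Suc m * (B1 + B2) / N ^ Suc m" for x y
  proof -
    have int: "integral {-pi..pi} (\<lambda>s. U y s * w k s) = (\<Sum>l<N. cos y ^ l * a k l)" for k
    proof (rule integral_unique)
      have "((\<lambda>s. \<Sum>l<N. cos y ^ l * (c l s * w k s)) has_integral (\<Sum>l<N. cos y ^ l * a k l)) {-pi..pi}"
        unfolding a_def
        by (intro has_integral_sum has_integral_mult_right integrable_integral integrable_continuous_real
            continuous_intros c_cont wc) auto
      moreover have "U y s * w k s = (\<Sum>l<N. cos y ^ l * (c l s * w k s))" for s
        by (simp add: U_def sum_distrib_right mult.assoc)
      ultimately show "((\<lambda>s. U y s * w k s) has_integral (\<Sum>l<N. cos y ^ l * a k l)) {-pi..pi}"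
        by simp
    qed
    have "U y x - ?R (U y) x = (\<Sum>k<N. \<Sum>l<N. a k l * cos x ^ k * cos y ^ l)"
      unfolding w(2)[OF U_good] int by (simp add: sum_distrib_left mult_ac)
    then have "H x y - (\<Sum>k<N. \<Sum>l<N. a k l * cos x ^ k * cos y ^ l)
        = ?R (\<lambda>x. H x y) x + ((H x y - U y x) - (?R (\<lambda>x. H x y) x - ?R (U y) x))"
      by simp
    also have "?R (\<lambda>x. H x y) x - ?R (U y) x = ?R (\<lambda>x. H x y - U y x) x"
      by (rule residual_power_diff[symmetric]) (rule Hc Uc)+
    finally have eq: "H x y - (\<Sum>k<N. \<Sum>l<N. a k l * cos x ^ k * cos y ^ l)
        = ?R (\<lambda>x. H x y) x + ((H x y - U y x) - ?R (\<lambda>x. H x y - U y x) x)" .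
    have 1: "\<bar>?R (\<lambda>x. H x y) x\<bar> \<le> B1 * \<omega>"
      unfolding \<omega>_def by (intro residual_power_smooth_bound N smooth)
    have 2: "\<bar>H x y - U y x\<bar> \<le> B2 * \<omega>" for x
      unfolding \<omega>_def U by (intro residual_power_smooth_bound N smooth)
    have 3: "\<bar>?R (\<lambda>x. H x y - U y x) x\<bar> \<le> 2 ^ Suc m * (B2 * \<omega>)"
      by (rule residual_power_bound[OF N continuous_on_diff[OF Hc Uc] 2])
    have "\<bar>H x y - (\<Sum>k<N. \<Sum>l<N. a k l * cos x ^ k * cos y ^ l)\<bar> \<le> B1 * \<omega> + B2 * \<omega> + 2 ^ Suc m * (B2 * \<omega>)"
      using 1 2[of x] 3 unfolding eq by linarith
    also have "\<dots> \<le> (1 + 2 ^ Suc m) * ((B1 + B2) * \<omega>)"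
      using B \<open>\<omega> \<ge> 0\<close> by (simp add: algebra_simps)
    also have "\<dots> = (1 + 2 ^ Suc m) * (1 + pi ^ 4) ^ Suc m * (B1 + B2) / N ^ Suc m"
      unfolding \<omega>_def power_divide by simp
    finally show ?thesis .
  qed
  then show ?thesis by blast
qed

lemma jackson_square:
  fixes f :: "real \<Rightarrow> real \<Rightarrow> real"
  assumes N: "N \<ge> 2"
    and cont: "continuous_on ({-1..1} \<times> {-1..1}) (\<lambda>(x, y). f x y)"
    and smooth: "\<And>y. y \<in> {-1..1} \<Longrightarrow> lip_smooth m B1 (\<lambda>\<theta>. f (cos \<theta>) y)"
      "\<And>x. x \<in> {-1..1} \<Longrightarrow> lip_smooth m B2 (\<lambda>\<theta>. f x (cos \<theta>))"
    and B: "B1 \<ge> 0" "B2 \<ge> 0"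
  shows "\<exists>c. \<forall>x\<in>{-1..1}. \<forall>y\<in>{-1..1}. \<bar>f x y - (\<Sum>k<N. \<Sum>l<N. c k l * x ^ k * y ^ l)\<bar>
    \<le> (1 + 2 ^ Suc m) * (1 + pi ^ 4) ^ Suc m * (B1 + B2) / N ^ Suc m"
proof -
  define H where "H \<theta> \<phi> = f (cos \<theta>) (cos \<phi>)" for \<theta> \<phi>
  have cos_in: "cos \<theta> \<in> {-1..1}" for \<theta> :: real
    by simp
  have smooth': "lip_smooth m B1 (\<lambda>\<theta>. H \<theta> \<phi>)" "lip_smooth m B2 (H \<theta>)" for \<theta> \<phi>
    using smooth(1)[OF cos_in[of \<phi>]] smooth(2)[OF cos_in[of \<theta>]] by (simp_all add: H_def[abs_def])
  have "continuous_on UNIV (\<lambda>p. (\<lambda>(x, y). f x y) (cos (fst p), cos (snd p)))"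
    by (rule continuous_on_compose2[OF cont]) (auto intro!: continuous_intros)
  then have "continuous_on UNIV (\<lambda>(x, y). H x y)"
    by (simp add: H_def case_prod_unfold)
  moreover have "even_periodic (\<lambda>x. H x y)" "even_periodic (H x)" for x y
    using lip_smooth_continuous[OF smooth'(1)] lip_smooth_continuous[OF smooth'(2)]
    by (simp_all add: even_periodic_def) (simp_all add: H_def)
  ultimately obtain c where c: "\<And>x y. \<bar>H x y - (\<Sum>k<N. \<Sum>l<N. c k l * cos x ^ k * cos y ^ l)\<bar>
    \<le> (1 + 2 ^ Suc m) * (1 + pi ^ 4) ^ Suc m * (B1 + B2) / N ^ Suc m"
    using jackson_trigonometric_two_variables[OF N _ _ _ smooth' B] by blast
  have "\<bar>f x y - (\<Sum>k<N. \<Sum>l<N. c k l * x ^ k * y ^ l)\<bar>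
    \<le> (1 + 2 ^ Suc m) * (1 + pi ^ 4) ^ Suc m * (B1 + B2) / N ^ Suc m"
    if "x \<in> {-1..1}" "y \<in> {-1..1}" for x y
    using c[of "arccos x" "arccos y"] that by (simp add: H_def)
  then show ?thesis by blast
qed

section \<open>Derivative bounds for compositions with the cosine\<close>

text \<open>All orders up to m share the bound B, so that the class is closed under products, as the
  chain rule for g (cos \<theta>) requires.\<close>

fun bdd_smooth :: "nat \<Rightarrow> real \<Rightarrow> (real \<Rightarrow> real) \<Rightarrow> bool" where
  "bdd_smooth 0 B F \<longleftrightarrow> (\<forall>x. \<bar>F x\<bar> \<le> B)"
| "bdd_smooth (Suc m) B F \<longleftrightarrow> (\<forall>x. \<bar>F x\<bar> \<le> B) \<and>
    (\<exists>F'. (\<forall>x. (F has_real_derivative F' x) (at x)) \<and> bdd_smooth m B F')"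

lemma bdd_smooth_bound: "bdd_smooth m B F \<Longrightarrow> \<bar>F x\<bar> \<le> B"
  by (cases m) auto

lemma bdd_smooth_SucI:
  assumes "\<And>x. \<bar>F x\<bar> \<le> B" "\<And>x. (F has_real_derivative F' x) (at x)" "bdd_smooth m B F'"
  shows "bdd_smooth (Suc m) B F"
  unfolding bdd_smooth.simps(2)
  by (intro conjI allI exI[of _ F'] assms)

lemma bdd_smooth_imp_lip_smooth: "bdd_smooth (Suc m) B F \<Longrightarrow> lip_smooth m B F"
proof (induction m arbitrary: F)
  case 0
  then obtain F' where F': "\<And>x. (F has_real_derivative F' x) (at x)" "\<And>x. \<bar>F' x\<bar> \<le> B"
    by auto
  have "norm (F x - F y) \<le> B * norm (x - y)" for x y
    by (rule field_differentiable_bound[of UNIV F F']) (auto simp: F')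
  then show ?case by simp
next
  case (Suc m)
  then show ?case
    by (metis bdd_smooth.simps(2) lip_smooth.simps(2))
qed

lemma bdd_smooth_SucD: "bdd_smooth (Suc m) B F \<Longrightarrow> bdd_smooth m B F"
proof (induction m arbitrary: F)
  case (Suc m)
  then show ?case
    by (metis bdd_smooth.simps(2))
qed auto

lemma bdd_smooth_mono: "bdd_smooth m A F \<Longrightarrow> A \<le> B \<Longrightarrow> bdd_smooth m B F"
proof (induction m arbitrary: F)
  case (Suc m)
  then obtain F' where "\<And>x. (F has_real_derivative F' x) (at x)" "bdd_smooth m A F'"
    by auto
  with Suc show ?case
    by (intro bdd_smooth_SucI[of _ _ F'] order_trans[OF bdd_smooth_bound[OF Suc.prems(1)]]) auto
qed (auto intro: order_trans)

lemma bdd_smooth_add: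
  "bdd_smooth m A F \<Longrightarrow> bdd_smooth m B G \<Longrightarrow> bdd_smooth m (A + B) (\<lambda>x. F x + G x)"
proof (induction m arbitrary: F G)
  case 0
  then show ?case
    by (auto intro!: order_trans[OF abs_triangle_ineq] add_mono)
next
  case (Suc m)
  then obtain F' G' where "\<And>x. (F has_real_derivative F' x) (at x)" "bdd_smooth m A F'"
    "\<And>x. (G has_real_derivative G' x) (at x)" "bdd_smooth m B G'"
    by auto
  then have "\<And>x. ((\<lambda>x. F x + G x) has_real_derivative F' x + G' x) (at x)"
    "bdd_smooth m (A + B) (\<lambda>x. F' x + G' x)"
    by (auto intro!: derivative_intros Suc.IH)
  moreover have "\<bar>F x + G x\<bar> \<le> A + B" for x
    using bdd_smooth_bound[OF Suc.prems(1), of x] bdd_smooth_bound[OF Suc.prems(2), of x] by linarith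
  ultimately show ?case
    by (intro bdd_smooth_SucI[of _ _ "\<lambda>x. F' x + G' x"])
qed

text \<open>Each differentiation replaces a product by two products, whence the factor 2 per
  order.\<close>

lemma bdd_smooth_mult:
  "bdd_smooth m A F \<Longrightarrow> bdd_smooth m B G \<Longrightarrow> bdd_smooth m (2 ^ m * (A * B)) (\<lambda>x. F x * G x)"
proof (induction m arbitrary: F G)
  case 0
  then have "0 \<le> A" by (meson abs_ge_zero bdd_smooth.simps(1) order_trans)
  with 0 show ?case
    by (auto simp: abs_mult intro!: mult_mono)
next
  case (Suc m)
  then obtain F' G' where F': "\<And>x. (F has_real_derivative F' x) (at x)" "bdd_smooth m A F'"
    and G': "\<And>x. (G has_real_derivative G' x) (at x)" "bdd_smooth m B G'"
    by auto
  have nonneg: "A \<ge> 0" "B \<ge> 0"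
    using bdd_smooth_bound[OF Suc.prems(1), of 0] bdd_smooth_bound[OF Suc.prems(2), of 0] by auto
  have "bdd_smooth m (2 ^ m * (A * B) + 2 ^ m * (A * B)) (\<lambda>x. F' x * G x + F x * G' x)"
    by (rule bdd_smooth_add[OF Suc.IH[OF F'(2) bdd_smooth_SucD[OF Suc.prems(2)]]
          Suc.IH[OF bdd_smooth_SucD[OF Suc.prems(1)] G'(2)]])
  then have "bdd_smooth m (2 ^ Suc m * (A * B)) (\<lambda>x. F' x * G x + F x * G' x)"
    by (simp only: mult_2[symmetric] power_Suc mult.assoc)
  moreover have "((\<lambda>x. F x * G x) has_real_derivative F' x * G x + F x * G' x) (at x)" for x
    using DERIV_mult[OF F'(1) G'(1), of x] by (simp add: algebra_simps)
  moreover have "\<bar>F x * G x\<bar> \<le> 2 ^ Suc m * (A * B)" for x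
  proof -
    have "\<bar>F x * G x\<bar> \<le> 1 * (A * B)"
      using bdd_smooth_bound[OF Suc.prems(1), of x] bdd_smooth_bound[OF Suc.prems(2), of x] nonneg
      by (auto simp: abs_mult intro!: mult_mono)
    also have "\<dots> \<le> 2 ^ Suc m * (A * B)"
      using nonneg by (intro mult_right_mono one_le_power) auto
    finally show ?thesis .
  qed
  ultimately show ?case
    by (intro bdd_smooth_SucI[of _ _ "\<lambda>x. F' x * G x + F x * G' x"])
qed

text \<open>The phase a serves the induction: differentiating a cosine advances its phase by pi /
  2.\<close>

lemma bdd_smooth_cos: "bdd_smooth m 1 (\<lambda>x. cos (x + a))"
proof (induction m arbitrary: a)
  case (Suc m)
  have "((\<lambda>x. cos (x + a)) has_real_derivative cos (x + (a + pi / 2))) (at x)" for x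
  proof -
    have "cos (x + (a + pi / 2)) = - sin (x + a)"
      by (simp add: cos_add sin_add)
    then show ?thesis
      by (auto intro!: derivative_eq_intros)
  qed
  with Suc[of "a + pi / 2"] show ?case
    by (intro bdd_smooth_SucI[of _ _ "\<lambda>x. cos (x + (a + pi / 2))"]) auto
qed simp

text \<open>One chain rule step multiplies g' (cos \<theta>) by a shifted cosine and costs a factor
  2^m; the exponents fit because m + m^2 is at most (m + 1)^2. A whole sequence g of derivatives is
  given so that the induction can move on to its tail.\<close>

lemma bdd_smooth_comp_cos:
  assumes "\<And>j x. j < m \<Longrightarrow> x \<in> {-1..1} \<Longrightarrow> (g j has_real_derivative g (Suc j) x) (at x within {-1..1})"
    and "\<And>j x. j \<le> m \<Longrightarrow> x \<in> {-1..1} \<Longrightarrow> \<bar>g j x\<bar> \<le> 1"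
  shows "bdd_smooth m (2 ^ (m * m)) (\<lambda>\<theta>. g 0 (cos \<theta>))"
  using assms
proof (induction m arbitrary: g)
  case (Suc m)
  have "bdd_smooth m (2 ^ (m * m)) (\<lambda>\<theta>. g (Suc 0) (cos \<theta>))"
    by (rule Suc.IH[of "\<lambda>j. g (Suc j)"]) (auto intro!: Suc.prems)
  then have "bdd_smooth m (2 ^ m * (2 ^ (m * m) * 1)) (\<lambda>\<theta>. g (Suc 0) (cos \<theta>) * cos (\<theta> + pi / 2))"
    by (intro bdd_smooth_mult bdd_smooth_cos)
  then have "bdd_smooth m (2 ^ (Suc m * Suc m)) (\<lambda>\<theta>. g (Suc 0) (cos \<theta>) * cos (\<theta> + pi / 2))"
  proof (rule bdd_smooth_mono)
    show "2 ^ m * (2 ^ (m * m) * 1) \<le> (2 ^ (Suc m * Suc m) :: real)"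
      unfolding mult_1_right power_add[symmetric] by (rule power_increasing) auto
  qed
  moreover have "((\<lambda>\<theta>. g 0 (cos \<theta>)) has_real_derivative g (Suc 0) (cos \<theta>) * cos (\<theta> + pi / 2)) (at \<theta>)" for \<theta>
  proof -
    \<comment> \<open>A derivative within the range of the cosine is all the chain rule asks, so
      one-sided derivatives of g at the ends of [-1,1] yield a two-sided derivative in
      \<theta>.\<close>
    have "(g 0 has_real_derivative g (Suc 0) (cos \<theta>)) (at (cos \<theta>) within range cos)"
      using Suc.prems(1)[of 0 "cos \<theta>"] by (rule DERIV_subset) auto
    from DERIV_image_chain[OF this DERIV_cos] show ?thesis
      by (simp add: o_def cos_add)
  qed
  moreover have "\<bar>g 0 (cos \<theta>)\<bar> \<le> 2 ^ (Suc m * Suc m)" for \<theta>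
    using Suc.prems(2)[of 0 "cos \<theta>"] one_le_power[of "2::real" "Suc m * Suc m"] by simp
  ultimately show ?case
    by (intro bdd_smooth_SucI[of _ _ "\<lambda>\<theta>. g (Suc 0) (cos \<theta>) * cos (\<theta> + pi / 2)"])
qed auto

section \<open>Sup norms and partial derivatives on the cube\<close>

lemma cube_eq_cbox: "(cube :: (real ^ 'd) set) = cbox (- 1) 1"
  by (auto simp: cube_def mem_box_cart)

lemma abs_le_sup_norm:
  fixes f :: "real ^ 'd \<Rightarrow> real"
  assumes "continuous_on cube f" "x \<in> cube"
  shows "\<bar>f x\<bar> \<le> sup_norm f"
proof -
  have "compact ((\<lambda>x. \<bar>f x\<bar>) ` cube)"
    by (intro compact_continuous_image continuous_intros assms) (simp add: cube_eq_cbox)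
  then have "bdd_above ((\<lambda>x. \<bar>f x\<bar>) ` cube)"
    by (intro bounded_imp_bdd_above compact_imp_bounded)
  then show ?thesis
    unfolding sup_norm_def using assms(2) by (rule cSUP_upper2) simp
qed

lemma sup_norm_nonneg:
  fixes f :: "real ^ 'd \<Rightarrow> real"
  assumes "continuous_on cube f"
  shows "sup_norm f \<ge> 0"
  using abs_le_sup_norm[OF assms, of 0] by (simp add: cube_def)

lemma finite_msize_le: "finite {k :: 'd::finite \<Rightarrow> nat. msize k \<le> m}"
proof (rule finite_subset)
  show "{k :: 'd \<Rightarrow> nat. msize k \<le> m} \<subseteq> (\<Pi>\<^sub>E i\<in>UNIV. {..m})"
  proof
    fix k :: "'d \<Rightarrow> nat" assume "k \<in> {k. msize k \<le> m}"
    then have "k i \<le> m" for i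
      using member_le_sum[of i UNIV k] by (simp add: msize_def)
    then show "k \<in> (\<Pi>\<^sub>E i\<in>UNIV. {..m})" by auto
  qed
qed (intro finite_PiE, auto)

text \<open>The normalisation restricted to an arbitrary set S of multi-indices, so that each
  application can name just the derivatives it compares.\<close>

lemma W_partials:
  assumes "h \<in> W m"
  obtains D where "partials_upto m h D" "\<And>S. S \<subseteq> {k. 1 \<le> msize k \<and> msize k \<le> m} \<Longrightarrow>
    sup_norm h + (\<Sum>k\<in>S. sup_norm (D k)) \<le> 1"
proof -
  obtain D where D: "partials_upto m h D"
    and le: "sup_norm h + (\<Sum>k | 1 \<le> msize k \<and> msize k \<le> m. sup_norm (D k)) \<le> 1"
    using assms by (auto simp: W_def)
  have "sup_norm h + (\<Sum>k\<in>S. sup_norm (D k)) \<le> 1"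
    if "S \<subseteq> {k. 1 \<le> msize k \<and> msize k \<le> m}" for S
  proof -
    have "finite {k. 1 \<le> msize k \<and> msize k \<le> m}"
      by (rule finite_subset[OF _ finite_msize_le[of m]]) auto
    then have "(\<Sum>k\<in>S. sup_norm (D k)) \<le> (\<Sum>k | 1 \<le> msize k \<and> msize k \<le> m. sup_norm (D k))"
      using that D by (intro sum_mono2) (auto intro!: sup_norm_nonneg simp: partials_upto_def)
    with le show ?thesis by linarith
  qed
  with D show ?thesis using that by blast
qed

text \<open>The multi-index of an unmixed derivative: the two-variable Jackson estimate uses
  smoothness along one coordinate at a time.\<close>

definition pure :: "'d \<Rightarrow> nat \<Rightarrow> 'd \<Rightarrow> nat" where
  "pure i j = (\<lambda>_. 0)(i := j)"

lemma msize_pure [simp]: "msize (pure (i :: 'd::finite) j) = j"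
  by (simp add: msize_def pure_def)

lemma pure_zero: "pure i 0 = (\<lambda>_. 0)"
  by (auto simp: pure_def)

lemma partials_upto_pure:
  assumes "partials_upto m h D"
  shows "D (pure i 0) = h"
    and "j < m \<Longrightarrow> x \<in> cube \<Longrightarrow> has_partial (D (pure i j)) i (D (pure i (Suc j)) x) x"
    and "j \<le> m \<Longrightarrow> continuous_on cube (D (pure i j))"
proof -
  show "D (pure i 0) = h"
    using assms by (simp add: partials_upto_def pure_zero)
  show "continuous_on cube (D (pure i j))" if "j \<le> m"
    using assms that by (simp add: partials_upto_def)
  assume "j < m" "x \<in> cube"
  then have "has_partial (D (pure i j)) i (D ((pure i j)(i := Suc (pure i j i))) x) x"
    using assms unfolding partials_upto_def by simp
  then show "has_partial (D (pure i j)) i (D (pure i (Suc j)) x) x"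
    by (simp add: pure_def)
qed

lemma vector_in_cube [simp]: "(vector [s, t] :: real ^ 2) \<in> cube \<longleftrightarrow> s \<in> {-1..1} \<and> t \<in> {-1..1}"
  by (simp add: cube_def forall_2)

lemma vector_eq_axis: "(vector [s, t] :: real ^ 2) = s *\<^sub>R axis 1 1 + t *\<^sub>R axis 2 1"
  by (simp add: vec_eq_iff forall_2 axis_def)

lemma DERIV_within_shift:
  fixes f :: "real \<Rightarrow> real"
  assumes "((\<lambda>\<tau>. f (s + \<tau>)) has_real_derivative c) (at 0 within {\<tau>. s + \<tau> \<in> A})"
  shows "(f has_real_derivative c) (at s within A)"
proof -
  have "(\<lambda>u. u - s) ` A = {\<tau>. s + \<tau> \<in> A}"
    by (auto intro!: image_eqI[of _ _ "s + _"])
  with assms have "((\<lambda>\<tau>. f (s + \<tau>)) has_real_derivative c) (at (s - s) within (\<lambda>u. u - s) ` A)"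
    by simp
  moreover have "((\<lambda>u. u - s) has_real_derivative 1) (at s within A)"
    by (auto intro!: derivative_eq_intros)
  ultimately have "((\<lambda>\<tau>. f (s + \<tau>)) \<circ> (\<lambda>u. u - s) has_real_derivative c * 1) (at s within A)"
    by (rule DERIV_image_chain)
  then show ?thesis by (simp add: o_def)
qed

lemma has_partial_first:
  assumes "has_partial f 1 c (vector [s, t] :: real ^ 2)" "t \<in> {-1..1}"
  shows "((\<lambda>s. f (vector [s, t])) has_real_derivative c) (at s within {-1..1})"
proof (rule DERIV_within_shift)
  have "vector [s, t] + \<tau> *\<^sub>R axis 1 1 = (vector [s + \<tau>, t] :: real ^ 2)" for \<tau>
    by (simp add: vector_eq_axis scaleR_add_left)
  with assms show "((\<lambda>\<tau>. f (vector [s + \<tau>, t])) has_real_derivative c) (at 0 within {\<tau>. s + \<tau> \<in> {-1..1}})"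
    by (simp add: has_partial_def)
qed

lemma has_partial_second:
  assumes "has_partial f 2 c (vector [s, t] :: real ^ 2)" "s \<in> {-1..1}"
  shows "((\<lambda>t. f (vector [s, t])) has_real_derivative c) (at t within {-1..1})"
proof (rule DERIV_within_shift)
  have "vector [s, t] + \<tau> *\<^sub>R axis 2 1 = (vector [s, t + \<tau>] :: real ^ 2)" for \<tau>
    by (simp add: vector_eq_axis scaleR_add_left)
  with assms show "((\<lambda>\<tau>. f (vector [s, t + \<tau>])) has_real_derivative c) (at 0 within {\<tau>. t + \<tau> \<in> {-1..1}})"
    by (simp add: has_partial_def)
qed

section \<open>Polynomials as limits of shallow networks\<close>

text \<open>Lagrange interpolation at 0, ..., N - 1 reproduces x^l for l < N; reading off the
  coefficient of x^\<alpha> on both sides gives c, with c i the coefficient of x^\<alpha> in the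
  i-th basis polynomial.\<close>

lemma interpolation_functional:
  assumes "\<alpha> < N"
  shows "\<exists>c :: nat \<Rightarrow> real. \<forall>l<N. (\<Sum>i<N. c i * real i ^ l) = (if l = \<alpha> then 1 else 0)"
proof -
  define L :: "nat \<Rightarrow> real poly"
    where "L i = (\<Prod>j\<in>{..<N} - {i}. smult (1 / (real i - real j)) [:- real j, 1:])" for i
  have deg: "degree (L i) < N" if "i < N" for i
  proof -
    have "degree (L i) \<le> (\<Sum>j\<in>{..<N} - {i}. degree (smult (1 / (real i - real j)) [:- real j, 1:]))"
      unfolding L_def by (rule order_trans[OF degree_prod_sum_le]) auto
    also have "\<dots> \<le> (\<Sum>j\<in>{..<N} - {i}. 1)"
      by (rule sum_mono) (simp add: degree_smult_le)
    also have "\<dots> < N"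
      using that by simp
    finally show ?thesis .
  qed
  have eval: "poly (L i) (real j) = (if i = j then 1 else 0)" if "i < N" "j < N" for i j
  proof -
    have "poly (L i) (real j) = (\<Prod>k\<in>{..<N} - {i}. (real j - real k) / (real i - real k))"
      by (simp add: L_def poly_prod diff_divide_distrib)
    also have "\<dots> = (if i = j then 1 else 0)"
      using that by (auto intro!: prod.neutral)
    finally show ?thesis .
  qed
  have "(\<Sum>i<N. coeff (L i) \<alpha> * real i ^ l) = (if l = \<alpha> then 1 else 0)" if "l < N" for l
  proof -
    \<comment> \<open>The interpolation error of x^l: it has degree below N and vanishes at N nodes,
      hence is zero.\<close>
    define p where "p = (\<Sum>i<N. smult (real i ^ l) (L i)) - monom 1 l"
    have deg_p: "degree p < N"
      unfolding p_def using that deg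
      by (intro degree_diff_less degree_sum_less) (auto simp: degree_monom_eq intro: le_less_trans[OF degree_smult_le])
    have root: "poly p (real j) = 0" if "j < N" for j
    proof -
      have "(\<Sum>i<N. real i ^ l * poly (L i) (real j)) = (\<Sum>i<N. if i = j then real j ^ l else 0)"
        using that by (intro sum.cong) (auto simp: eval)
      then show ?thesis
        using that by (simp add: p_def poly_sum poly_monom)
    qed
    have "p = 0"
    proof (rule ccontr)
      assume "p \<noteq> 0"
      then have fin: "finite {x. poly p x = 0}"
        by (rule poly_roots_finite)
      have "real ` {..<N} \<subseteq> {x. poly p x = 0}"
        using root by auto
      from card_mono[OF fin this] have "N \<le> card {x. poly p x = 0}"
        by (simp add: card_image)
      also have "\<dots> \<le> degree p"
        using \<open>p \<noteq> 0\<close> by (rule card_poly_roots_bound)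
      finally show False using deg_p by simp
    qed
    then have "coeff p \<alpha> = 0" by simp
    then show ?thesis
      by (auto simp: p_def coeff_sum coeff_monom mult.commute split: if_splits)
  qed
  then show ?thesis
    by (intro exI[of _ "\<lambda>i. coeff (L i) \<alpha>"]) simp
qed

section \<open>Units with a smooth non-polynomial activation\<close>

locale smooth_activation =
  fixes \<sigma> :: "real \<Rightarrow> real"
  assumes smooth: "(deriv ^^ j) \<sigma> field_differentiable (at x)"
    and not_poly: "\<not> (\<exists>p. \<forall>x. \<sigma> x = poly p x)"
begin

lemma has_deriv: "((deriv ^^ j) \<sigma> has_real_derivative (deriv ^^ Suc j) \<sigma> x) (at x)"
  using smooth[of j x] by (simp add: field_differentiable_derivI)

lemma continuous_deriv: "continuous_on A ((deriv ^^ j) \<sigma>)"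
proof (rule DERIV_continuous_on)
  fix x
  show "((deriv ^^ j) \<sigma> has_real_derivative (deriv ^^ Suc j) \<sigma> x) (at x within A)"
    using has_deriv[of j x] by (rule has_field_derivative_at_within)
qed

text \<open>Otherwise the Maclaurin remainder of order j vanishes and \<sigma> is a
  polynomial.\<close>

lemma deriv_not_identically_zero: "\<exists>x. (deriv ^^ j) \<sigma> x \<noteq> 0"
proof (rule ccontr)
  assume "\<not> ?thesis"
  then have zero: "(deriv ^^ j) \<sigma> x = 0" for x by auto
  have "\<sigma> x = poly (\<Sum>k<j. monom ((deriv ^^ k) \<sigma> 0 / fact k) k) x" for x
  proof -
    have "\<exists>t. \<bar>t\<bar> \<le> \<bar>x\<bar> \<and>
      \<sigma> x = (\<Sum>k<j. (deriv ^^ k) \<sigma> 0 / fact k * x ^ k) + (deriv ^^ j) \<sigma> t / fact j * x ^ j"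
      by (rule Maclaurin_all_le) (use has_deriv in auto)
    then show ?thesis
      by (auto simp: zero poly_sum poly_monom)
  qed
  with not_poly show False by blast
qed

text \<open>Descending from order K, the open set shrinks at each order but stays nonempty: if the
  derivative of order k vanished on all of U, so would the one of order k + 1, which was arranged to
  be nonzero there.\<close>

lemma open_nonvanishing_derivs:
  assumes "k \<le> K"
  shows "\<exists>U. open U \<and> U \<noteq> {} \<and> (\<forall>x\<in>U. \<forall>j\<in>{k..K}. (deriv ^^ j) \<sigma> x \<noteq> 0)"
  using assms
proof (induction k rule: inc_induct)
  case base
  let ?U = "{x. (deriv ^^ K) \<sigma> x \<noteq> 0}"
  have "open ?U"
    by (intro open_Collect_neq continuous_deriv continuous_intros)
  moreover have "?U \<noteq> {}"
    using deriv_not_identically_zero by auto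
  ultimately show ?case
    by (intro exI[of _ ?U]) auto
next
  case (step k)
  then obtain U where U: "open U" "U \<noteq> {}" "\<And>x j. x \<in> U \<Longrightarrow> j \<in> {Suc k..K} \<Longrightarrow> (deriv ^^ j) \<sigma> x \<noteq> 0"
    by blast
  let ?V = "U \<inter> {x. (deriv ^^ k) \<sigma> x \<noteq> 0}"
  have "open ?V"
    by (intro open_Int U open_Collect_neq continuous_deriv continuous_intros)
  moreover have "?V \<noteq> {}"
  proof
    assume "?V = {}"
    then have zero: "(deriv ^^ k) \<sigma> x = 0" if "x \<in> U" for x
      using that by auto
    obtain x where "x \<in> U" using U by auto
    have "((deriv ^^ k) \<sigma> has_real_derivative 0) (at x)"
      by (rule has_field_derivative_transform_within_open[OF DERIV_const U(1) \<open>x \<in> U\<close>, of 0])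
        (simp add: zero)
    then have "(deriv ^^ Suc k) \<sigma> x = 0"
      using has_deriv DERIV_unique by blast
    with U(3)[of x "Suc k"] \<open>x \<in> U\<close> step.hyps show False by auto
  qed
  moreover have "(deriv ^^ j) \<sigma> x \<noteq> 0" if "x \<in> ?V" "j \<in> {k..K}" for x j
    using that U(3)[of x j] by (cases "j = k") auto
  ultimately show ?case
    by (intro exI[of _ ?V]) blast
qed

lemma ex_nonvanishing_derivs: "\<exists>b. \<forall>k\<le>K. (deriv ^^ k) \<sigma> b \<noteq> 0"
  using open_nonvanishing_derivs[of 0 K] by fastforce

lemma taylor_bound:
  "\<exists>R\<ge>0. \<forall>u. \<bar>u\<bar> \<le> r \<longrightarrow>
     \<bar>\<sigma> (b + u) - (\<Sum>k\<le>K. (deriv ^^ k) \<sigma> b / fact k * u ^ k)\<bar> \<le> R * \<bar>u\<bar> ^ Suc K"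
proof -
  have "compact ((deriv ^^ Suc K) \<sigma> ` {b - r..b + r})"
    by (intro compact_continuous_image continuous_deriv) auto
  then obtain R where R: "R \<ge> 0" "\<And>x. x \<in> {b - r..b + r} \<Longrightarrow> \<bar>(deriv ^^ Suc K) \<sigma> x\<bar> \<le> R"
    by (metis bounded_pos compact_imp_bounded imageI less_imp_le real_norm_def)
  have "\<bar>\<sigma> (b + u) - (\<Sum>k\<le>K. (deriv ^^ k) \<sigma> b / fact k * u ^ k)\<bar> \<le> R * \<bar>u\<bar> ^ Suc K" if "\<bar>u\<bar> \<le> r" for u
  proof -
    have "((\<lambda>x. (deriv ^^ j) \<sigma> (x + b)) has_real_derivative (deriv ^^ Suc j) \<sigma> (x + b)) (at x)" for j x
      using has_deriv[of j "x + b"] by (simp only: DERIV_shift)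
    then have "((\<lambda>x. (deriv ^^ j) \<sigma> (b + x)) has_real_derivative (deriv ^^ Suc j) \<sigma> (b + x)) (at x)" for j x
      by (simp only: add.commute[of b])
    then have "\<exists>t. \<bar>t\<bar> \<le> \<bar>u\<bar> \<and>
      \<sigma> (b + u) = (\<Sum>k<Suc K. (deriv ^^ k) \<sigma> (b + 0) / fact k * u ^ k) + (deriv ^^ Suc K) \<sigma> (b + t) / fact (Suc K) * u ^ Suc K"
      by (intro Maclaurin_all_le[of "\<lambda>j x. (deriv ^^ j) \<sigma> (b + x)"]) auto
    then obtain t where t: "\<bar>t\<bar> \<le> \<bar>u\<bar>"
      and eq: "\<sigma> (b + u) - (\<Sum>k\<le>K. (deriv ^^ k) \<sigma> b / fact k * u ^ k) = (deriv ^^ Suc K) \<sigma> (b + t) / fact (Suc K) * u ^ Suc K"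
      unfolding lessThan_Suc_atMost by auto
    have "b + t \<in> {b - r..b + r}"
      using t that by auto
    then have "\<bar>(deriv ^^ Suc K) \<sigma> (b + t)\<bar> / fact (Suc K) \<le> R / 1"
      using R(1) by (intro frac_le fact_ge_1 R(2)) auto
    then show ?thesis
      unfolding eq abs_mult abs_divide power_abs
      by (intro mult_right_mono) auto
  qed
  with R(1) show ?thesis by blast
qed

text \<open>The functionals \<open>c\<close> and \<open>d\<close> pick the exponents \<open>\<alpha>\<close> and \<open>\<beta>\<close>; in total degree at most
  \<open>\<alpha> + \<beta>\<close>, a monomial with one exponent \<open>\<ge> N\<close> has the other one below \<open>\<alpha>\<close> or \<open>\<beta>\<close>, so it is
  annihilated as well.\<close>

lemma double_sum_power:
  fixes x y :: real
  assumes c: "\<And>l. l < N \<Longrightarrow> (\<Sum>i<N. c i * real i ^ l) = (if l = \<alpha> then 1 else 0)"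
    and d: "\<And>l. l < N \<Longrightarrow> (\<Sum>i<N. d i * real i ^ l) = (if l = \<beta> then 1 else 0)"
    and "\<alpha> < N" "\<beta> < N" "k \<le> \<alpha> + \<beta>"
  shows "(\<Sum>i<N. \<Sum>j<N. c i * d j * (real i * x + real j * y) ^ k)
    = (if k = \<alpha> + \<beta> then real (k choose \<alpha>) * x ^ \<alpha> * y ^ \<beta> else 0)"
proof -
  define A where "A l = (\<Sum>i<N. c i * real i ^ l)" for l
  define B where "B l = (\<Sum>i<N. d i * real i ^ l)" for l
  have "(\<Sum>i<N. \<Sum>j<N. c i * d j * (real i * x + real j * y) ^ k)
      = (\<Sum>i<N. \<Sum>j<N. \<Sum>l\<le>k. real (k choose l) * x ^ l * y ^ (k - l) * (c i * real i ^ l) * (d j * real j ^ (k - l)))"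
    by (intro sum.cong refl)
      (simp add: binomial_ring sum_distrib_left power_mult_distrib mult_ac)
  also have "\<dots> = (\<Sum>l\<le>k. \<Sum>i<N. \<Sum>j<N. real (k choose l) * x ^ l * y ^ (k - l) * (c i * real i ^ l) * (d j * real j ^ (k - l)))"
    unfolding sum.swap[of _ "{..k}"] by simp
  also have "\<dots> = (\<Sum>l\<le>k. real (k choose l) * x ^ l * y ^ (k - l) * A l * B (k - l))"
    unfolding A_def B_def
    by (intro sum.cong refl) (simp add: sum_distrib_left sum_distrib_right mult_ac)
  also have "\<dots> = (\<Sum>l\<le>k. if l = \<alpha> \<and> k = \<alpha> + \<beta> then real (k choose \<alpha>) * x ^ \<alpha> * y ^ \<beta> else 0)"
  proof (rule sum.cong[OF refl])
    fix l assume l: "l \<in> {..k}"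
    show "real (k choose l) * x ^ l * y ^ (k - l) * A l * B (k - l)
      = (if l = \<alpha> \<and> k = \<alpha> + \<beta> then real (k choose \<alpha>) * x ^ \<alpha> * y ^ \<beta> else 0)"
    proof (cases "l = \<alpha> \<and> k = \<alpha> + \<beta>")
      case True
      then show ?thesis
        using assms by (simp add: A_def B_def)
    next
      case False
      have "A l = 0 \<or> B (k - l) = 0"
      proof (cases "l \<le> \<alpha>")
        case True
        then consider "l < \<alpha>" | "l = \<alpha>" "k - l < \<beta>"
          using False assms l by force
        then show ?thesis
          by cases (use assms in \<open>auto simp: A_def B_def\<close>)
      next
        case False
        then have "k - l < \<beta>" using assms l by auto
        then show ?thesis using assms by (auto simp: B_def)
      qed
      then show ?thesis using False by auto
    qed
  qed
  also have "\<dots> = (if k = \<alpha> + \<beta> then real (k choose \<alpha>) * x ^ \<alpha> * y ^ \<beta> else 0)"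
    by auto
  finally show ?thesis .
qed

text \<open>In the Taylor expansion of \<sigma> at b the functionals annihilate every order below
  \<alpha> + \<beta> and leave a multiple of t^(\<alpha> + \<beta>) times the monomial; the
  remainder is one order smaller in t. The inner weights depend on t, i and j but not on the
  monomial, and A is fixed before t, so that one t can serve all monomials.\<close>

lemma monomial_approximation:
  assumes "\<alpha> < N" "\<beta> < N" "(deriv ^^ (\<alpha> + \<beta>)) \<sigma> b \<noteq> 0"
  shows "\<exists>A\<ge>0. \<forall>t. 0 < t \<and> t \<le> 1 \<longrightarrow> (\<exists>a. \<forall>x y. \<bar>x\<bar> \<le> 1 \<and> \<bar>y\<bar> \<le> 1 \<longrightarrow>
    \<bar>x ^ \<alpha> * y ^ \<beta> - (\<Sum>i<N. \<Sum>j<N. a i j * \<sigma> (t * (real i * x + real j * y) + b))\<bar> \<le> A * t)"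
proof -
  obtain c where c: "\<And>l. l < N \<Longrightarrow> (\<Sum>i<N. c i * real i ^ l) = (if l = \<alpha> then 1 else 0)"
    using interpolation_functional[OF assms(1)] by blast
  obtain d where d: "\<And>l. l < N \<Longrightarrow> (\<Sum>i<N. d i * real i ^ l) = (if l = \<beta> then 1 else 0)"
    using interpolation_functional[OF assms(2)] by blast
  define K where "K = \<alpha> + \<beta>"
  define s where "s k = (deriv ^^ k) \<sigma> b / fact k" for k
  \<comment> \<open>Taylor coefficient times the binomial coefficient with which the monomial occurs
    in (i x + j y)^K.\<close>
  define q where "q = s K * real (K choose \<alpha>)"
  have "q \<noteq> 0"
    using assms(3) by (simp add: q_def s_def K_def)
  obtain R where R: "R \<ge> 0"
    "\<And>u. \<bar>u\<bar> \<le> 2 * real N \<Longrightarrow> \<bar>\<sigma> (b + u) - (\<Sum>k\<le>K. s k * u ^ k)\<bar> \<le> R * \<bar>u\<bar> ^ Suc K"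
    using taylor_bound[of "2 * real N" b K] unfolding s_def by blast
  define A where "A = (\<Sum>i<N. \<Sum>j<N. \<bar>c i * d j\<bar> * (R * (2 * real N) ^ Suc K)) / \<bar>q\<bar>"
  have "A \<ge> 0"
    unfolding A_def using R(1) by (intro divide_nonneg_nonneg sum_nonneg mult_nonneg_nonneg) auto
  moreover have "\<exists>a. \<forall>x y. \<bar>x\<bar> \<le> 1 \<and> \<bar>y\<bar> \<le> 1 \<longrightarrow>
    \<bar>x ^ \<alpha> * y ^ \<beta> - (\<Sum>i<N. \<Sum>j<N. a i j * \<sigma> (t * (real i * x + real j * y) + b))\<bar> \<le> A * t"
    if t: "0 < t" "t \<le> 1" for t
  proof (intro exI[of _ "\<lambda>i j. c i * d j / (q * t ^ K)"] allI impI)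
    fix x y :: real assume xy: "\<bar>x\<bar> \<le> 1 \<and> \<bar>y\<bar> \<le> 1"
    define v where "v i j = real i * x + real j * y" for i j
    define e where "e i j = \<sigma> (b + t * v i j) - (\<Sum>k\<le>K. s k * (t * v i j) ^ k)" for i j
    have v: "\<bar>v i j\<bar> \<le> 2 * real N" if "i < N" "j < N" for i j
    proof -
      have "\<bar>v i j\<bar> \<le> real i * \<bar>x\<bar> + real j * \<bar>y\<bar>"
        unfolding v_def by (rule order_trans[OF abs_triangle_ineq]) (simp add: abs_mult)
      also have "\<dots> \<le> real N * 1 + real N * 1"
        using that xy by (intro add_mono mult_mono) auto
      finally show ?thesis by simp
    qed
    have e: "\<bar>e i j\<bar> \<le> R * (2 * real N) ^ Suc K * t ^ Suc K" if "i < N" "j < N" for i j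
    proof -
      have "\<bar>t * v i j\<bar> \<le> t * (2 * real N)"
        using v[OF that] t by (simp add: abs_mult)
      moreover have "t * (2 * real N) \<le> 1 * (2 * real N)"
        using t by (intro mult_right_mono) auto
      ultimately have "\<bar>e i j\<bar> \<le> R * \<bar>t * v i j\<bar> ^ Suc K"
        unfolding e_def by (intro R(2)) simp
      also have "\<dots> \<le> R * (t * (2 * real N)) ^ Suc K"
        using \<open>\<bar>t * v i j\<bar> \<le> t * (2 * real N)\<close> R(1) by (intro mult_left_mono power_mono) auto
      finally show ?thesis
        by (simp add: power_mult_distrib mult_ac)
    qed
    have "(\<Sum>i<N. \<Sum>j<N. c i * d j * (\<Sum>k\<le>K. s k * (t * v i j) ^ k))
        = (\<Sum>i<N. \<Sum>j<N. \<Sum>k\<le>K. s k * t ^ k * (c i * d j * v i j ^ k))"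
      by (intro sum.cong refl) (simp add: sum_distrib_left power_mult_distrib mult_ac)
    also have "\<dots> = (\<Sum>k\<le>K. \<Sum>i<N. \<Sum>j<N. s k * t ^ k * (c i * d j * v i j ^ k))"
      unfolding sum.swap[of _ "{..K}"] by simp
    also have "\<dots> = (\<Sum>k\<le>K. s k * t ^ k * (\<Sum>i<N. \<Sum>j<N. c i * d j * v i j ^ k))"
      by (simp add: sum_distrib_left)
    also have "\<dots> = (\<Sum>k\<le>K. if k = K then s K * t ^ K * (real (K choose \<alpha>) * x ^ \<alpha> * y ^ \<beta>) else 0)"
    proof (rule sum.cong[OF refl])
      fix k assume "k \<in> {..K}"
      then show "s k * t ^ k * (\<Sum>i<N. \<Sum>j<N. c i * d j * v i j ^ k)
        = (if k = K then s K * t ^ K * (real (K choose \<alpha>) * x ^ \<alpha> * y ^ \<beta>) else 0)"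
        unfolding v_def by (subst double_sum_power[OF c d assms(1,2)]) (auto simp: K_def)
    qed
    also have "\<dots> = q * t ^ K * (x ^ \<alpha> * y ^ \<beta>)"
      by (simp add: q_def mult_ac)
    finally have main: "(\<Sum>i<N. \<Sum>j<N. c i * d j * (\<Sum>k\<le>K. s k * (t * v i j) ^ k)) = q * t ^ K * (x ^ \<alpha> * y ^ \<beta>)" .
    have "(\<Sum>i<N. \<Sum>j<N. c i * d j / (q * t ^ K) * \<sigma> (t * (real i * x + real j * y) + b))
        = (\<Sum>i<N. \<Sum>j<N. c i * d j * ((\<Sum>k\<le>K. s k * (t * v i j) ^ k) + e i j)) / (q * t ^ K)"
      by (simp add: sum_divide_distrib e_def v_def add.commute)
    also have "\<dots> = (q * t ^ K * (x ^ \<alpha> * y ^ \<beta>) + (\<Sum>i<N. \<Sum>j<N. c i * d j * e i j)) / (q * t ^ K)"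
      by (simp only: distrib_left sum.distrib main)
    also have "\<dots> = x ^ \<alpha> * y ^ \<beta> + (\<Sum>i<N. \<Sum>j<N. c i * d j * e i j) / (q * t ^ K)"
      using \<open>q \<noteq> 0\<close> t by (simp add: field_simps)
    finally have "\<bar>x ^ \<alpha> * y ^ \<beta> - (\<Sum>i<N. \<Sum>j<N. c i * d j / (q * t ^ K) * \<sigma> (t * (real i * x + real j * y) + b))\<bar>
        = \<bar>\<Sum>i<N. \<Sum>j<N. c i * d j * e i j\<bar> / (\<bar>q\<bar> * t ^ K)"
      using t by (simp add: abs_mult)
    also have "\<bar>\<Sum>i<N. \<Sum>j<N. c i * d j * e i j\<bar> \<le> (\<Sum>i<N. \<Sum>j<N. \<bar>c i * d j\<bar> * (R * (2 * real N) ^ Suc K * t ^ Suc K))"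
    proof (intro order_trans[OF sum_abs] sum_mono)
      fix i j assume "i \<in> {..<N}" "j \<in> {..<N}"
      then have "\<bar>c i * d j\<bar> * \<bar>e i j\<bar> \<le> \<bar>c i * d j\<bar> * (R * (2 * real N) ^ Suc K * t ^ Suc K)"
        by (intro mult_left_mono e) auto
      then show "\<bar>c i * d j * e i j\<bar> \<le> \<bar>c i * d j\<bar> * (R * (2 * real N) ^ Suc K * t ^ Suc K)"
        by (simp only: abs_mult)
    qed
    then have "\<bar>\<Sum>i<N. \<Sum>j<N. c i * d j * e i j\<bar> / (\<bar>q\<bar> * t ^ K)
      \<le> (\<Sum>i<N. \<Sum>j<N. \<bar>c i * d j\<bar> * (R * (2 * real N) ^ Suc K * t ^ Suc K)) / (\<bar>q\<bar> * t ^ K)"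
      using t by (intro divide_right_mono) auto
    also have "\<dots> = (\<Sum>i<N. \<Sum>j<N. \<bar>c i * d j\<bar> * (R * (2 * real N) ^ Suc K)) * t ^ Suc K / (\<bar>q\<bar> * t ^ K)"
      by (simp add: sum_distrib_right mult.assoc)
    also have "\<dots> = A * t"
      using t \<open>q \<noteq> 0\<close> by (simp add: A_def)
    finally show "\<bar>x ^ \<alpha> * y ^ \<beta> - (\<Sum>i<N. \<Sum>j<N. c i * d j / (q * t ^ K) * \<sigma> (t * (real i * x + real j * y) + b))\<bar> \<le> A * t" .
  qed
  ultimately show ?thesis by blast
qed

lemma shallow_sum:
  assumes "finite S" "card S = M"
  shows "(\<lambda>x. \<Sum>s\<in>S. a s * \<sigma> (w s \<bullet> x + b s)) \<in> shallow \<sigma> M"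
proof -
  obtain h where h: "bij_betw h {1..M} S"
    using ex_bij_betw_nat_finite_1[OF assms(1)] assms(2) by blast
  have "(\<Sum>s\<in>S. a s * \<sigma> (w s \<bullet> x + b s)) = (\<Sum>k=1..M. a (h k) * \<sigma> (w (h k) \<bullet> x + b (h k)))" for x
    by (rule sum.reindex_bij_betw[OF h, symmetric])
  then show ?thesis
    unfolding shallow_def
    by (intro CollectI exI[of _ "\<lambda>k. w (h k)"] exI[of _ "\<lambda>k. a (h k)"] exI[of _ "\<lambda>k. b (h k)"]) auto
qed

text \<open>Units with zero inner weight, the value shared equally among them. Exact constants
  matter for nodes of modulus 1, where no error of the range could be tolerated.\<close>

lemma shallow_const:
  assumes "M \<ge> 1"
  shows "(\<lambda>_. c) \<in> shallow \<sigma> M"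
proof -
  obtain b where b: "\<sigma> b \<noteq> 0"
    using deriv_not_identically_zero[of 0] by auto
  have "(\<lambda>x. \<Sum>k\<in>{1..M}. c / (real M * \<sigma> b) * \<sigma> (0 \<bullet> x + b)) \<in> shallow \<sigma> M"
    by (rule shallow_sum) auto
  then show ?thesis
    using assms b by simp
qed

lemma polynomial_approximation:
  fixes c :: "nat \<Rightarrow> nat \<Rightarrow> real"
  assumes "\<eta> > 0"
  shows "\<exists>P \<in> shallow \<sigma> (N * N). \<forall>x\<in>cube.
    \<bar>(\<Sum>k<N. \<Sum>l<N. c k l * (x $ 1) ^ k * (x $ 2) ^ l) - P (x :: real ^ 2)\<bar> \<le> \<eta>"
proof -
  \<comment> \<open>A single b serves all monomials, whose total degrees stay below 2 N.\<close>
  obtain b where b: "\<And>k. k \<le> 2 * N \<Longrightarrow> (deriv ^^ k) \<sigma> b \<noteq> 0"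
    using ex_nonvanishing_derivs by blast
  define good where "good k l t E a \<longleftrightarrow> (\<forall>x y. \<bar>x\<bar> \<le> 1 \<and> \<bar>y\<bar> \<le> 1 \<longrightarrow>
    \<bar>x ^ k * y ^ l - (\<Sum>i<N. \<Sum>j<N. a i j * \<sigma> (t * (real i * x + real j * y) + b))\<bar> \<le> E * t)"
    for k l t E and a :: "nat \<Rightarrow> nat \<Rightarrow> real"
  have "\<exists>E\<ge>0. \<forall>t. 0 < t \<and> t \<le> 1 \<longrightarrow> (\<exists>a. good k l t E a)" if "k < N" "l < N" for k l
    unfolding good_def using that by (intro monomial_approximation b) auto
  then obtain A where A: "\<And>k l. k < N \<Longrightarrow> l < N \<Longrightarrow> A k l \<ge> 0"
    and a_ex: "\<And>k l t. k < N \<Longrightarrow> l < N \<Longrightarrow> 0 < t \<Longrightarrow> t \<le> 1 \<Longrightarrow> \<exists>a. good k l t (A k l) a"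
    by metis
  define B where "B = (\<Sum>k<N. \<Sum>l<N. \<bar>c k l\<bar> * A k l)"
  have "B \<ge> 0"
    unfolding B_def by (intro sum_nonneg mult_nonneg_nonneg A) auto
  \<comment> \<open>The \<open>B + 1\<close> avoids a vanishing denominator when all coefficients c
    are zero.\<close>
  define t where "t = min 1 (\<eta> / (B + 1))"
  have t: "0 < t" "t \<le> 1"
    using assms \<open>B \<ge> 0\<close> by (auto simp: t_def)
  have Bt: "B * t \<le> \<eta>"
  proof -
    have "B * t \<le> (B + 1) * (\<eta> / (B + 1))"
      using \<open>B \<ge> 0\<close> t by (intro mult_mono) (auto simp: t_def)
    then show ?thesis
      using \<open>B \<ge> 0\<close> by simp
  qed
  obtain a where a: "\<And>k l. k < N \<Longrightarrow> l < N \<Longrightarrow> good k l t (A k l) (a k l)"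
    using a_ex[OF _ _ t] by metis
  let ?S = "{..<N} \<times> {..<N}"
  have dbl: "(\<Sum>i<N. \<Sum>j<N. f i j) = (\<Sum>p\<in>?S. f (fst p) (snd p))" for f :: "nat \<Rightarrow> nat \<Rightarrow> real"
    by (simp add: sum.cartesian_product case_prod_unfold)
  define u where "u p x = \<sigma> (t * (real (fst p) * x $ 1 + real (snd p) * x $ 2) + b)" for p and x :: "real ^ 2"
  define C where "C q = c (fst q) (snd q)" for q
  define a' where "a' q p = a (fst q) (snd q) (fst p) (snd p)" for q p
  \<comment> \<open>All monomials share the same units \<open>u p\<close>, so only their outer
    coefficients add up and N * N units suffice for the whole polynomial.\<close>
  define P where "P x = (\<Sum>p\<in>?S. (\<Sum>q\<in>?S. C q * a' q p) * u p x)" for x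
  have "P \<in> shallow \<sigma> (N * N)"
  proof -
    have "(\<lambda>x. \<Sum>p\<in>?S. (\<Sum>q\<in>?S. C q * a' q p)
        * \<sigma> ((vector [t * real (fst p), t * real (snd p)] :: real ^ 2) \<bullet> x + b)) \<in> shallow \<sigma> (N * N)"
      by (rule shallow_sum) auto
    moreover have "(vector [t * real i, t * real j] :: real ^ 2) \<bullet> x = t * (real i * x $ 1 + real j * x $ 2)"
      for i j x
      by (simp add: inner_vec_def sum_2 algebra_simps)
    ultimately show ?thesis
      by (simp add: P_def[abs_def] u_def)
  qed
  moreover have "\<bar>(\<Sum>k<N. \<Sum>l<N. c k l * (x $ 1) ^ k * (x $ 2) ^ l) - P x\<bar> \<le> \<eta>" if "x \<in> cube" for x
  proof -
    have x: "\<bar>x $ 1\<bar> \<le> 1" "\<bar>x $ 2\<bar> \<le> 1"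
      using that by (auto simp: cube_def abs_le_iff minus_le_iff)
    have "P x = (\<Sum>p\<in>?S. \<Sum>q\<in>?S. C q * (a' q p * u p x))"
      unfolding P_def by (simp only: sum_distrib_right mult.assoc)
    also have "\<dots> = (\<Sum>q\<in>?S. C q * (\<Sum>p\<in>?S. a' q p * u p x))"
      by (subst sum.swap) (simp only: sum_distrib_left)
    finally have "(\<Sum>k<N. \<Sum>l<N. c k l * (x $ 1) ^ k * (x $ 2) ^ l) - P x
      = (\<Sum>q\<in>?S. C q * ((x $ 1) ^ fst q * (x $ 2) ^ snd q - (\<Sum>p\<in>?S. a' q p * u p x)))"
      unfolding dbl by (simp only: sum_subtractf right_diff_distrib C_def mult.assoc)
    also have "\<bar>\<dots>\<bar> \<le> (\<Sum>q\<in>?S. \<bar>C q\<bar> * (A (fst q) (snd q) * t))"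
    proof (intro order_trans[OF sum_abs] sum_mono)
      fix q assume "q \<in> ?S"
      then have "good (fst q) (snd q) t (A (fst q) (snd q)) (a (fst q) (snd q))"
        by (intro a) auto
      then have "\<bar>(x $ 1) ^ fst q * (x $ 2) ^ snd q - (\<Sum>p\<in>?S. a' q p * u p x)\<bar> \<le> A (fst q) (snd q) * t"
        using x unfolding good_def dbl u_def a'_def by blast
      then have "\<bar>C q\<bar> * \<bar>(x $ 1) ^ fst q * (x $ 2) ^ snd q - (\<Sum>p\<in>?S. a' q p * u p x)\<bar>
          \<le> \<bar>C q\<bar> * (A (fst q) (snd q) * t)"
        by (intro mult_left_mono) auto
      then show "\<bar>C q * ((x $ 1) ^ fst q * (x $ 2) ^ snd q - (\<Sum>p\<in>?S. a' q p * u p x))\<bar>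
          \<le> \<bar>C q\<bar> * (A (fst q) (snd q) * t)"
        by (simp only: abs_mult)
    qed
    also have "\<dots> = B * t"
      unfolding B_def dbl C_def by (simp only: sum_distrib_right mult.assoc)
    finally show ?thesis using Bt by linarith
  qed
  ultimately show ?thesis by blast
qed

end

section \<open>Constituent functions\<close>

lemma vector_eta: "vector [x $ 1, x $ 2] = (x :: real ^ 2)"
  by (simp add: vec_eq_iff forall_2)

lemma cube_two_eq: "x \<in> cube \<longleftrightarrow> \<bar>x $ 1\<bar> \<le> 1 \<and> \<bar>x $ (2 :: 2)\<bar> \<le> 1"
  by (auto simp: cube_def forall_2)

lemma continuous_on_vector:
  fixes h :: "real ^ 2 \<Rightarrow> real"
  assumes "continuous_on cube h" "\<bar>a\<bar> \<le> 1" "\<bar>b\<bar> \<le> 1"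
  shows "continuous_on ({-1..1} \<times> {-1..1}) (\<lambda>(x, y). h (vector [a * x, b * y]))"
  unfolding case_prod_unfold
proof (rule continuous_on_compose2[OF assms(1)])
  show "continuous_on ({-1..1} \<times> {-1..1}) (\<lambda>p. vector [a * fst p, b * snd p] :: real ^ 2)"
    unfolding vector_eq_axis by (intro continuous_intros)
  have "\<bar>a * x\<bar> \<le> 1" "\<bar>b * x\<bar> \<le> 1" if "\<bar>x\<bar> \<le> 1" for x
    using mult_mono[OF assms(2) that] mult_mono[OF assms(3) that] by (simp_all add: abs_mult)
  then show "(\<lambda>p. vector [a * fst p, b * snd p] :: real ^ 2) ` ({-1..1} \<times> {-1..1}) \<subseteq> cube"
    by (auto simp: cube_two_eq)
qed

text \<open>A Landau-type inequality: on an interval of length 1 the mean value theorem gives a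
  point where |g'| is at most 2 s, and from there to x the derivative changes by at most q.\<close>

lemma abs_deriv_le:
  fixes g g' g'' :: "real \<Rightarrow> real"
  assumes g: "\<And>x. x \<in> {-1..1} \<Longrightarrow> (g has_real_derivative g' x) (at x within {-1..1})"
    and g': "\<And>x. x \<in> {-1..1} \<Longrightarrow> (g' has_real_derivative g'' x) (at x within {-1..1})"
    and s: "\<And>x. x \<in> {-1..1} \<Longrightarrow> \<bar>g x\<bar> \<le> s" and q: "\<And>x. x \<in> {-1..1} \<Longrightarrow> \<bar>g'' x\<bar> \<le> q"
    and x: "x \<in> {-1..1}"
  shows "\<bar>g' x\<bar> \<le> 2 * s + q"
proof -
  \<comment> \<open>Left end of a unit interval inside [-1,1] that contains x.\<close>
  define u where "u = (if x \<le> 0 then x else x - 1)"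
  have u: "{u..u + 1} \<subseteq> {-1..1}" "x \<in> {u..u + 1}"
    using x by (auto simp: u_def)
  have "\<exists>\<xi>\<in>{u<..<u + 1}. g (u + 1) - g u = g' \<xi> * (u + 1 - u)"
  proof (rule mvt_simple[of _ _ g "\<lambda>y. (*) (g' y)"])
    fix y assume "u \<le> y" "y \<le> u + 1"
    then have "(g has_real_derivative g' y) (at y within {u..u + 1})"
      using u(1) by (intro DERIV_subset[OF g]) auto
    then show "(g has_derivative (*) (g' y)) (at y within {u..u + 1})"
      by (simp add: has_field_derivative_def)
  qed simp
  then obtain \<xi> where \<xi>: "\<xi> \<in> {u<..<u + 1}" "g (u + 1) - g u = g' \<xi>"
    by auto
  have "\<bar>g (u + 1)\<bar> \<le> s" "\<bar>g u\<bar> \<le> s"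
    using u(1) by (auto intro!: s)
  then have "\<bar>g' \<xi>\<bar> \<le> 2 * s"
    using \<xi>(2) by linarith
  moreover have "norm (g' x - g' \<xi>) \<le> q * norm (x - \<xi>)"
    using u \<xi>(1) x by (intro field_differentiable_bound[of "{-1..1}", OF _ g']) (auto intro: q)
  moreover have "q * norm (x - \<xi>) \<le> q * 1"
    using u \<xi>(1) x q[OF x] by (intro mult_left_mono) auto
  ultimately show ?thesis by simp
qed

lemma W_bounded:
  fixes h :: "real ^ 2 \<Rightarrow> real"
  assumes "h \<in> W m" "x \<in> cube"
  shows "\<bar>h x\<bar> \<le> 1"
proof -
  obtain D where D: "partials_upto m h D"
    and S: "\<And>S. S \<subseteq> {k. 1 \<le> msize k \<and> msize k \<le> m} \<Longrightarrow> sup_norm h + (\<Sum>k\<in>S. sup_norm (D k)) \<le> 1"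
    using W_partials[OF assms(1)] by blast
  have "continuous_on cube h"
    using partials_upto_pure(3)[OF D, of 0 1] partials_upto_pure(1)[OF D, of 1] by simp
  from abs_le_sup_norm[OF this assms(2)] S[of "{}"] show ?thesis by simp
qed

lemma W_lipschitz:
  fixes h :: "real ^ 2 \<Rightarrow> real"
  assumes h: "h \<in> W m" and m: "m \<ge> 1"
  obtains s L1 L2 where "s \<ge> 0" "L1 \<ge> 0" "L2 \<ge> 0" "s + L1 + L2 \<le> 1" "continuous_on cube h"
    "\<forall>x\<in>cube. \<bar>h x\<bar> \<le> s"
    "\<forall>x\<in>cube. \<forall>y\<in>cube. \<bar>h x - h y\<bar> \<le> L1 * \<bar>x $ 1 - y $ 1\<bar> + L2 * \<bar>x $ 2 - y $ 2\<bar>"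
    "m \<ge> 2 \<longrightarrow> L1 + L2 \<le> 4 / 5"
proof -
  obtain D where D: "partials_upto m h D"
    and S: "\<And>S. S \<subseteq> {k. 1 \<le> msize k \<and> msize k \<le> m} \<Longrightarrow> sup_norm h + (\<Sum>k\<in>S. sup_norm (D k)) \<le> 1"
    using W_partials[OF h] by blast
  have cont: "continuous_on cube h"
    using partials_upto_pure(3)[OF D, of 0 1] partials_upto_pure(1)[OF D, of 1] by simp
  let ?L = "\<lambda>i j. sup_norm (D (pure i j))"
  have sup: "\<bar>D (pure i j) x\<bar> \<le> ?L i j" "0 \<le> ?L i j" if "j \<le> m" "x \<in> cube" for i j x
    using abs_le_sup_norm sup_norm_nonneg partials_upto_pure(3)[OF D that(1)] that(2) by blast+
  \<comment> \<open>The multi-indices must be distinct, so that each contributes its own term to the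
    normalising sum.\<close>
  have neq: "pure 1 j \<noteq> (pure 2 k :: 2 \<Rightarrow> nat)" if "j \<noteq> 0" for j k
    using that by (auto simp: pure_def fun_eq_iff intro!: exI[of _ 1])
  have neq': "pure i 1 \<noteq> (pure i 2 :: 2 \<Rightarrow> nat)" for i
    by (metis msize_pure numeral_eq_one_iff num.distinct(1))
  have D0: "D (pure i 0) = h" for i
    by (rule partials_upto_pure(1)[OF D])
  have zero: "(0 :: real ^ 2) \<in> cube"
    by (simp add: cube_def)
  have d1: "((\<lambda>s. D (pure 1 j) (vector [s, t])) has_real_derivative D (pure 1 (Suc j)) (vector [s, t])) (at s within {-1..1})"
    if "j < m" "s \<in> {-1..1}" "t \<in> {-1..1}" for j s t
    using that by (intro has_partial_first partials_upto_pure(2)[OF D]) auto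
  have d2: "((\<lambda>t. D (pure 2 j) (vector [s, t])) has_real_derivative D (pure 2 (Suc j)) (vector [s, t])) (at t within {-1..1})"
    if "j < m" "s \<in> {-1..1}" "t \<in> {-1..1}" for j s t
    using that by (intro has_partial_second partials_upto_pure(2)[OF D]) auto
  have lip: "\<bar>h x - h y\<bar> \<le> ?L 1 1 * \<bar>x $ 1 - y $ 1\<bar> + ?L 2 1 * \<bar>x $ 2 - y $ 2\<bar>"
    if "x \<in> cube" "y \<in> cube" for x y
  proof -
    have in_I: "x $ 1 \<in> {-1..1}" "x $ 2 \<in> {-1..1}" "y $ 1 \<in> {-1..1}" "y $ 2 \<in> {-1..1}"
      using that by (auto simp: cube_def)
    have "norm (h (vector [x $ 1, x $ 2]) - h (vector [y $ 1, x $ 2])) \<le> ?L 1 1 * norm (x $ 1 - y $ 1)"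
      by (rule field_differentiable_bound[of "{-1..1}" "\<lambda>s. h (vector [s, x $ 2])" "\<lambda>s. D (pure 1 1) (vector [s, x $ 2])"])
        (use d1[of 0] D0 m in_I sup(1)[of 1] in auto)
    moreover have "norm (h (vector [y $ 1, x $ 2]) - h (vector [y $ 1, y $ 2])) \<le> ?L 2 1 * norm (x $ 2 - y $ 2)"
      by (rule field_differentiable_bound[of "{-1..1}" "\<lambda>s. h (vector [y $ 1, s])" "\<lambda>s. D (pure 2 1) (vector [y $ 1, s])"])
        (use d2[of 0] D0 m in_I sup(1)[of 1] in auto)
    ultimately show ?thesis
      by (simp add: vector_eta)
  qed
  have sum: "sup_norm h + ?L 1 1 + ?L 2 1 \<le> 1"
    using S[of "{pure 1 1, pure 2 1}"] m neq[of 1 1] by simp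
  have contr: "?L 1 1 + ?L 2 1 \<le> 4 / 5" if "m \<ge> 2"
  proof -
    have 1: "?L 1 1 \<le> 2 * sup_norm h + ?L 1 2"
      unfolding sup_norm_def[of "D (pure 1 1)"]
    proof (rule cSUP_least)
      fix x :: "real ^ 2" assume x: "x \<in> cube"
      then have x_in: "x $ 1 \<in> {-1..1}" "x $ 2 \<in> {-1..1}"
        by (auto simp: cube_def)
      have "\<bar>D (pure 1 1) (vector [x $ 1, x $ 2])\<bar> \<le> 2 * sup_norm h + ?L 1 2"
        by (rule abs_deriv_le[of "\<lambda>s. h (vector [s, x $ 2])" "\<lambda>s. D (pure 1 1) (vector [s, x $ 2])"
              "\<lambda>s. D (pure 1 2) (vector [s, x $ 2])"])
          (use d1[of 0] d1[of 1] D0 that sup(1)[of 2] abs_le_sup_norm[OF cont] x_in in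
            \<open>auto simp: numeral_2_eq_2\<close>)
      then show "\<bar>D (pure 1 1) x\<bar> \<le> 2 * sup_norm h + ?L 1 2"
        by (simp add: vector_eta)
    qed (use zero in auto)
    have 2: "?L 2 1 \<le> 2 * sup_norm h + ?L 2 2"
      unfolding sup_norm_def[of "D (pure 2 1)"]
    proof (rule cSUP_least)
      fix x :: "real ^ 2" assume x: "x \<in> cube"
      then have x_in: "x $ 1 \<in> {-1..1}" "x $ 2 \<in> {-1..1}"
        by (auto simp: cube_def)
      have "\<bar>D (pure 2 1) (vector [x $ 1, x $ 2])\<bar> \<le> 2 * sup_norm h + ?L 2 2"
        by (rule abs_deriv_le[of "\<lambda>s. h (vector [x $ 1, s])" "\<lambda>s. D (pure 2 1) (vector [x $ 1, s])"
              "\<lambda>s. D (pure 2 2) (vector [x $ 1, s])"])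
          (use d2[of 0] d2[of 1] D0 that sup(1)[of 2] abs_le_sup_norm[OF cont] x_in in
            \<open>auto simp: numeral_2_eq_2\<close>)
      then show "\<bar>D (pure 2 1) x\<bar> \<le> 2 * sup_norm h + ?L 2 2"
        by (simp add: vector_eta)
    qed (use zero in auto)
    have "sup_norm h + (?L 1 1 + (?L 1 2 + (?L 2 1 + ?L 2 2))) \<le> 1"
      using S[of "{pure 1 1, pure 1 2, pure 2 1, pure 2 2}"] that neq neq' by simp
    \<comment> \<open>Let L be the sum of the two first-order norms and q that of the second-order
      ones. Then L is at most 4 \<open>sup_norm h\<close> + q; adding four times
      \<open>sup_norm h\<close> + L + q \<le> 1 gives 5 L \<le> 4.\<close>
    with 1 2 sup(2)[OF that zero, of 1] sup(2)[OF that zero, of 2] show ?thesis by linarith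
  qed
  show ?thesis
    by (rule that[OF sup_norm_nonneg[OF cont] sup(2)[OF m zero] sup(2)[OF m zero] sum cont])
      (use abs_le_sup_norm[OF cont] lip contr in blast)+
qed

section \<open>Polynomial approximation of constituents\<close>

text \<open>The constant of the Jackson estimate on the square, with \<open>2 ^ (m * m)\<close> from
  the cosine substitution as the bound in each variable.\<close>

definition jackson_const :: "nat \<Rightarrow> real" where
  "jackson_const m = (1 + 2 ^ m) * (1 + pi ^ 4) ^ m * (2 * 2 ^ (m * m))"

lemma jackson_const_pos: "jackson_const m > 0"
  unfolding jackson_const_def by (intro mult_pos_pos zero_less_power add_pos_pos) auto

lemma W_polynomial:
  fixes h :: "real ^ 2 \<Rightarrow> real"
  assumes h: "h \<in> W m" and m: "m \<ge> 1" and N: "N \<ge> 2"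
  shows "\<exists>c. \<forall>x\<in>cube. \<bar>h x - (\<Sum>k<N. \<Sum>l<N. c k l * (x $ 1) ^ k * (x $ 2) ^ l)\<bar> \<le> jackson_const m / N ^ m"
proof -
  obtain n where n: "m = Suc n"
    using m by (cases m) auto
  obtain D where D: "partials_upto m h D"
    and S: "\<And>S. S \<subseteq> {k. 1 \<le> msize k \<and> msize k \<le> m} \<Longrightarrow> sup_norm h + (\<Sum>k\<in>S. sup_norm (D k)) \<le> 1"
    using W_partials[OF h] by blast
  have D0: "D (pure i 0) = h" for i
    by (rule partials_upto_pure(1)[OF D])
  have cont: "continuous_on cube h"
    using partials_upto_pure(3)[OF D, of 0 1] D0 by simp
  have D1: "\<bar>D (pure i j) x\<bar> \<le> 1" if "j \<le> m" "x \<in> cube" for i j x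
  proof (cases "j = 0")
    case True
    then show ?thesis
      using W_bounded[OF h that(2)] D0 by simp
  next
    case False
    have "\<bar>D (pure i j) x\<bar> \<le> sup_norm (D (pure i j))"
      by (intro abs_le_sup_norm partials_upto_pure[OF D] that)
    then show ?thesis
      using S[of "{pure i j}"] False that sup_norm_nonneg[OF cont] by simp
  qed
  have "\<exists>c. \<forall>x\<in>{-1..1}. \<forall>y\<in>{-1..1}. \<bar>h (vector [x, y]) - (\<Sum>k<N. \<Sum>l<N. c k l * x ^ k * y ^ l)\<bar>
    \<le> (1 + 2 ^ Suc n) * (1 + pi ^ 4) ^ Suc n * (2 ^ (m * m) + 2 ^ (m * m)) / N ^ Suc n"
  proof (rule jackson_square[OF N])
    show "continuous_on ({-1..1} \<times> {-1..1}) (\<lambda>(x, y). h (vector [x, y]))"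
      using continuous_on_vector[OF cont, of 1 1] by simp
  next
    fix t :: real assume t: "t \<in> {-1..1}"
    have "bdd_smooth m (2 ^ (m * m)) (\<lambda>\<theta>. D (pure 1 0) (vector [cos \<theta>, t]))"
      by (rule bdd_smooth_comp_cos[of m "\<lambda>j s. D (pure 1 j) (vector [s, t])"])
        (use t in \<open>auto intro!: has_partial_first partials_upto_pure(2)[OF D] D1\<close>)
    then show "lip_smooth n (2 ^ (m * m)) (\<lambda>\<theta>. h (vector [cos \<theta>, t]))"
      unfolding D0 by (intro bdd_smooth_imp_lip_smooth) (simp only: n)
    have "bdd_smooth m (2 ^ (m * m)) (\<lambda>\<theta>. D (pure 2 0) (vector [t, cos \<theta>]))"
      by (rule bdd_smooth_comp_cos[of m "\<lambda>j s. D (pure 2 j) (vector [t, s])"])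
        (use t in \<open>auto intro!: has_partial_second partials_upto_pure(2)[OF D] D1\<close>)
    then show "lip_smooth n (2 ^ (m * m)) (\<lambda>\<theta>. h (vector [t, cos \<theta>]))"
      unfolding D0 by (intro bdd_smooth_imp_lip_smooth) (simp only: n)
  qed auto
  then obtain c where c: "\<And>x y. x \<in> {-1..1} \<Longrightarrow> y \<in> {-1..1} \<Longrightarrow>
      \<bar>h (vector [x, y]) - (\<Sum>k<N. \<Sum>l<N. c k l * x ^ k * y ^ l)\<bar> \<le> jackson_const m / N ^ m"
    unfolding jackson_const_def n mult_2 by blast
  have "\<bar>h x - (\<Sum>k<N. \<Sum>l<N. c k l * (x $ 1) ^ k * (x $ 2) ^ l)\<bar> \<le> jackson_const m / N ^ m"
    if "x \<in> cube" for x
    using c[of "x $ 1" "x $ 2"] that by (simp add: cube_def vector_eta)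
  then show ?thesis by blast
qed

lemma abs_cos_diff_le: "\<bar>cos x - cos y\<bar> \<le> \<bar>x - y :: real\<bar>"
proof -
  have "norm (cos x - cos y) \<le> 1 * norm (x - y)"
    by (rule field_differentiable_bound[of UNIV cos "\<lambda>x. - sin x"]) (auto intro!: derivative_eq_intros)
  then show ?thesis by simp
qed

text \<open>Stretching the rectangle to the square multiplies the Lipschitz constants by the radii,
  so the error shrinks with the rectangle. The 3 is 1 + 2^1, the case of a single residual
  factor.\<close>

lemma lipschitz_polynomial:
  fixes h :: "real ^ 2 \<Rightarrow> real"
  assumes N: "N \<ge> 2" and cont: "continuous_on cube h"
    and lip: "\<And>x y. x \<in> cube \<Longrightarrow> y \<in> cube \<Longrightarrow> \<bar>h x - h y\<bar> \<le> L1 * \<bar>x $ 1 - y $ 1\<bar> + L2 * \<bar>x $ 2 - y $ 2\<bar>"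
    and L: "L1 \<ge> 0" "L2 \<ge> 0" and r: "0 \<le> r1" "r1 \<le> 1" "0 \<le> r2" "r2 \<le> 1"
  shows "\<exists>c. \<forall>x. \<bar>x $ 1\<bar> \<le> r1 \<and> \<bar>x $ 2\<bar> \<le> r2 \<longrightarrow>
    \<bar>h x - (\<Sum>k<N. \<Sum>l<N. c k l * (x $ 1) ^ k * (x $ 2) ^ l)\<bar> \<le> 3 * (1 + pi ^ 4) / N * (L1 * r1 + L2 * r2)"
proof -
  have r_le: "\<bar>r1 * x\<bar> \<le> 1" "\<bar>r2 * x\<bar> \<le> 1" if "\<bar>x\<bar> \<le> 1" for x
    using mult_mono[of r1 1 "\<bar>x\<bar>" 1] mult_mono[of r2 1 "\<bar>x\<bar>" 1] that r by (simp_all add: abs_mult)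
  have "\<exists>c. \<forall>x\<in>{-1..1}. \<forall>y\<in>{-1..1}. \<bar>h (vector [r1 * x, r2 * y]) - (\<Sum>k<N. \<Sum>l<N. c k l * x ^ k * y ^ l)\<bar>
    \<le> (1 + 2 ^ Suc 0) * (1 + pi ^ 4) ^ Suc 0 * (L1 * r1 + L2 * r2) / N ^ Suc 0"
  proof (rule jackson_square[OF N])
    show "continuous_on ({-1..1} \<times> {-1..1}) (\<lambda>(x, y). h (vector [r1 * x, r2 * y]))"
      using r by (intro continuous_on_vector cont) auto
  next
    fix t :: real assume t: "t \<in> {-1..1}"
    have "\<bar>h (vector [r1 * cos x, r2 * t]) - h (vector [r1 * cos y, r2 * t])\<bar> \<le> L1 * r1 * \<bar>x - y\<bar>" for x y
    proof -
      have "\<bar>h (vector [r1 * cos x, r2 * t]) - h (vector [r1 * cos y, r2 * t])\<bar> \<le> L1 * \<bar>r1 * cos x - r1 * cos y\<bar>"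
        using lip[of "vector [r1 * cos x, r2 * t]" "vector [r1 * cos y, r2 * t]"] t
        by (auto simp: cube_two_eq r_le)
      also have "\<bar>r1 * cos x - r1 * cos y\<bar> \<le> r1 * \<bar>x - y\<bar>"
        unfolding right_diff_distrib[symmetric] abs_mult
        using r by (auto intro!: mult_left_mono abs_cos_diff_le)
      finally show ?thesis
        using L by (simp add: mult_left_mono mult.assoc)
    qed
    then show "lip_smooth 0 (L1 * r1) (\<lambda>\<theta>. h (vector [r1 * cos \<theta>, r2 * t]))"
      by simp
    have "\<bar>h (vector [r1 * t, r2 * cos x]) - h (vector [r1 * t, r2 * cos y])\<bar> \<le> L2 * r2 * \<bar>x - y\<bar>" for x y
    proof -
      have "\<bar>h (vector [r1 * t, r2 * cos x]) - h (vector [r1 * t, r2 * cos y])\<bar> \<le> L2 * \<bar>r2 * cos x - r2 * cos y\<bar>"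
        using lip[of "vector [r1 * t, r2 * cos x]" "vector [r1 * t, r2 * cos y]"] t
        by (auto simp: cube_two_eq r_le)
      also have "\<bar>r2 * cos x - r2 * cos y\<bar> \<le> r2 * \<bar>x - y\<bar>"
        unfolding right_diff_distrib[symmetric] abs_mult
        using r by (auto intro!: mult_left_mono abs_cos_diff_le)
      finally show ?thesis
        using L by (simp add: mult_left_mono mult.assoc)
    qed
    then show "lip_smooth 0 (L2 * r2) (\<lambda>\<theta>. h (vector [r1 * t, r2 * cos \<theta>]))"
      by simp
  qed (use L r in auto)
  moreover have "(1 + 2 ^ Suc 0) * (1 + pi ^ 4) ^ Suc 0 * (L1 * r1 + L2 * r2) / N ^ Suc 0
      = 3 * (1 + pi ^ 4) / N * (L1 * r1 + L2 * r2)"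
    by simp
  ultimately have "\<exists>c. \<forall>x\<in>{-1..1}. \<forall>y\<in>{-1..1}. \<bar>h (vector [r1 * x, r2 * y]) - (\<Sum>k<N. \<Sum>l<N. c k l * x ^ k * y ^ l)\<bar>
      \<le> 3 * (1 + pi ^ 4) / N * (L1 * r1 + L2 * r2)"
    by (simp only:)
  then obtain c where c: "\<And>x y. x \<in> {-1..1} \<Longrightarrow> y \<in> {-1..1} \<Longrightarrow>
      \<bar>h (vector [r1 * x, r2 * y]) - (\<Sum>k<N. \<Sum>l<N. c k l * x ^ k * y ^ l)\<bar> \<le> 3 * (1 + pi ^ 4) / N * (L1 * r1 + L2 * r2)"
    by blast
  have "\<bar>h x - (\<Sum>k<N. \<Sum>l<N. c k l / (r1 ^ k * r2 ^ l) * (x $ 1) ^ k * (x $ 2) ^ l)\<bar> \<le> 3 * (1 + pi ^ 4) / N * (L1 * r1 + L2 * r2)"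
    if x: "\<bar>x $ 1\<bar> \<le> r1" "\<bar>x $ 2\<bar> \<le> r2" for x :: "real ^ 2"
  proof -
    \<comment> \<open>If a radius is 0, so is the coordinate, and the convention x / 0 = 0 keeps the
      identity valid.\<close>
    have "r1 * (x $ 1 / r1) = x $ 1" "r2 * (x $ 2 / r2) = x $ 2"
      using x by auto
    moreover have "x $ 1 / r1 \<in> {-1..1}" "x $ 2 / r2 \<in> {-1..1}"
      using x r abs_le_D1 abs_le_D2 by (auto simp: divide_le_eq le_divide_eq minus_le_iff)
    ultimately have "\<bar>h x - (\<Sum>k<N. \<Sum>l<N. c k l * (x $ 1 / r1) ^ k * (x $ 2 / r2) ^ l)\<bar> \<le> 3 * (1 + pi ^ 4) / N * (L1 * r1 + L2 * r2)"
      using c[of "x $ 1 / r1" "x $ 2 / r2"] by (simp only: vector_eta)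
    moreover have "c k l / (r1 ^ k * r2 ^ l) * (x $ 1) ^ k * (x $ 2) ^ l = c k l * (x $ 1 / r1) ^ k * (x $ 2 / r2) ^ l" for k l
      by (simp add: power_divide)
    ultimately show ?thesis
      by (simp only:)
  qed
  then show ?thesis
    by (intro exI[of _ "\<lambda>k l. c k l / (r1 ^ k * r2 ^ l)"]) simp
qed

section \<open>Propagation of errors through the tree\<close>

text \<open>The induction common to m = 1 and m \<ge> 2, which differ only in the relation I between
  the error e of a subtree and the radius r of the range of its network. In \<open>node\<close>, y
  is the true input and z the one computed by the networks below; P may be chosen to suit the errors
  and radii of both children.\<close>

lemma tree_error_propagation:
  fixes I :: "real \<Rightarrow> real \<Rightarrow> bool" and t :: "(real ^ 2 \<Rightarrow> real) btree"
  assumes leaf: "I 0 1"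
    and node: "\<And>h e1 r1 e2 r2. h \<in> H \<Longrightarrow> I e1 r1 \<Longrightarrow> I e2 r2 \<Longrightarrow>
      \<exists>P\<in>S. \<exists>e r. I e r \<and> (\<forall>y z. y \<in> cube \<and> \<bar>z $ 1\<bar> \<le> r1 \<and> \<bar>z $ 2\<bar> \<le> r2 \<and>
        \<bar>y $ 1 - z $ 1\<bar> \<le> e1 \<and> \<bar>y $ 2 - z $ 2\<bar> \<le> e2 \<longrightarrow> \<bar>h y - P z\<bar> \<le> e \<and> \<bar>P z\<bar> \<le> r)"
    and bound: "\<And>h y. h \<in> H \<Longrightarrow> y \<in> cube \<Longrightarrow> \<bar>h y\<bar> \<le> 1"
  shows "set_btree t \<subseteq> H \<Longrightarrow> \<exists>t' e r. architecture t' = architecture t \<and> set_btree t' \<subseteq> S \<and> I e r \<and>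
    (\<forall>x. (\<forall>i\<in>set (leaves t). x i \<in> {-1..1}) \<longrightarrow>
      \<bar>compose t x\<bar> \<le> 1 \<and> \<bar>compose t x - compose t' x\<bar> \<le> e \<and> \<bar>compose t' x\<bar> \<le> r)"
proof (induction t)
  case (Leaf i)
  show ?case
    by (intro exI[of _ "Leaf i"] exI[of _ 0] exI[of _ 1]) (use leaf in auto)
next
  case (Node h u v)
  obtain u' e1 r1 where u': "architecture u' = architecture u" "set_btree u' \<subseteq> S" "I e1 r1"
    "\<And>x. (\<forall>i\<in>set (leaves u). x i \<in> {-1..1}) \<Longrightarrow>
      \<bar>compose u x\<bar> \<le> 1 \<and> \<bar>compose u x - compose u' x\<bar> \<le> e1 \<and> \<bar>compose u' x\<bar> \<le> r1"
    using Node.IH(1) Node.prems by auto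
  obtain v' e2 r2 where v': "architecture v' = architecture v" "set_btree v' \<subseteq> S" "I e2 r2"
    "\<And>x. (\<forall>i\<in>set (leaves v). x i \<in> {-1..1}) \<Longrightarrow>
      \<bar>compose v x\<bar> \<le> 1 \<and> \<bar>compose v x - compose v' x\<bar> \<le> e2 \<and> \<bar>compose v' x\<bar> \<le> r2"
    using Node.IH(2) Node.prems by auto
  have "h \<in> H"
    using Node.prems by simp
  from node[OF this u'(3) v'(3)] obtain P e r where P: "P \<in> S" "I e r"
    "\<And>y z. y \<in> cube \<Longrightarrow> \<bar>z $ 1\<bar> \<le> r1 \<Longrightarrow> \<bar>z $ 2\<bar> \<le> r2 \<Longrightarrow> \<bar>y $ 1 - z $ 1\<bar> \<le> e1 \<Longrightarrow>
      \<bar>y $ 2 - z $ 2\<bar> \<le> e2 \<Longrightarrow> \<bar>h y - P z\<bar> \<le> e \<and> \<bar>P z\<bar> \<le> r"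
    by blast
  have "\<bar>compose (Node h u v) x\<bar> \<le> 1 \<and> \<bar>compose (Node h u v) x - compose (Node P u' v') x\<bar> \<le> e \<and>
      \<bar>compose (Node P u' v') x\<bar> \<le> r" if x: "\<forall>i\<in>set (leaves (Node h u v)). x i \<in> {-1..1}" for x
  proof -
    have "\<forall>i\<in>set (leaves u). x i \<in> {-1..1}" "\<forall>i\<in>set (leaves v). x i \<in> {-1..1}"
      using x by auto
    note uv = u'(4)[OF this(1)] v'(4)[OF this(2)]
    then have "(vector [compose u x, compose v x] :: real ^ 2) \<in> cube"
      by (simp add: cube_two_eq)
    then show ?thesis
      using uv bound[OF \<open>h \<in> H\<close>] P(3)[of "vector [compose u x, compose v x]" "vector [compose u' x, compose v' x]"]
      by simp
  qed
  then show ?case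
    using u' v' P(1,2) by (intro exI[of _ "Node P u' v'"] exI[of _ e] exI[of _ r]) auto
qed

section \<open>Replacing one constituent by a shallow network\<close>

context smooth_activation
begin

text \<open>The network imitates (1 - \<kappa>) h rather than h, so that an error of \<kappa> cannot
  push its values out of [-1,1]. The level 10 \<kappa> is a fixed point: the contraction leaves 8
  \<kappa> of it, shrinking h costs \<kappa>, and approximation costs \<kappa>.\<close>

lemma node_contraction:
  fixes h :: "real ^ 2 \<Rightarrow> real"
  assumes h: "h \<in> W m" and m: "m \<ge> 2" and N: "N \<ge> 2"
    and \<kappa>: "0 < \<kappa>" "\<kappa> \<le> 1" "2 * jackson_const m / N ^ m \<le> \<kappa>"
    and inv: "e1 \<le> 10 * \<kappa> \<and> r1 \<le> 1" "e2 \<le> 10 * \<kappa> \<and> r2 \<le> 1"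
  shows "\<exists>P\<in>shallow \<sigma> (N * N). \<exists>e r. (e \<le> 10 * \<kappa> \<and> r \<le> 1) \<and> (\<forall>y (z :: real ^ 2). y \<in> cube \<and> \<bar>z $ 1\<bar> \<le> r1 \<and> \<bar>z $ 2\<bar> \<le> r2 \<and>
        \<bar>y $ 1 - z $ 1\<bar> \<le> e1 \<and> \<bar>y $ 2 - z $ 2\<bar> \<le> e2 \<longrightarrow> \<bar>h y - P z\<bar> \<le> e \<and> \<bar>P z\<bar> \<le> r)"
proof -
  have m1: "m \<ge> 1" using m by simp
  obtain s L1 L2 where "s \<ge> 0" and L: "L1 \<ge> 0" "L2 \<ge> 0" "s + L1 + L2 \<le> 1"
    and cont: "continuous_on cube h" and "\<forall>x\<in>cube. \<bar>h x\<bar> \<le> s"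
    and lip: "\<forall>x\<in>cube. \<forall>y\<in>cube. \<bar>h x - h y\<bar> \<le> L1 * \<bar>x $ 1 - y $ 1\<bar> + L2 * \<bar>x $ 2 - y $ 2\<bar>"
    and contr: "m \<ge> 2 \<longrightarrow> L1 + L2 \<le> 4 / 5"
    by (rule W_lipschitz[OF h m1])
  note lip = lip[rule_format]
  have contr: "L1 + L2 \<le> 4 / 5" using contr m by simp
  obtain c where c: "\<And>x. x \<in> cube \<Longrightarrow> \<bar>h x - (\<Sum>k<N. \<Sum>l<N. c k l * (x $ 1) ^ k * (x $ 2) ^ l)\<bar> \<le> jackson_const m / N ^ m"
    using W_polynomial[OF h m1 N] by blast
  \<comment> \<open>Half of \<kappa> goes to the polynomial, by the hypothesis on N, and half to its
    realisation by units.\<close>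
  obtain P :: "real ^ 2 \<Rightarrow> real" where P: "P \<in> shallow \<sigma> (N * N)"
    "\<And>x. x \<in> cube \<Longrightarrow> \<bar>(\<Sum>k<N. \<Sum>l<N. (1 - \<kappa>) * c k l * (x $ 1) ^ k * (x $ 2) ^ l) - P x\<bar> \<le> \<kappa> / 2"
    using polynomial_approximation[OF half_gt_zero[OF \<kappa>(1)], of N "\<lambda>k l. (1 - \<kappa>) * c k l"] by blast
  have approx: "\<bar>(1 - \<kappa>) * h z - P z\<bar> \<le> \<kappa>" if "z \<in> cube" for z
  proof -
    let ?p = "\<Sum>k<N. \<Sum>l<N. c k l * (z $ 1) ^ k * (z $ 2) ^ l"
    have "(1 - \<kappa>) * \<bar>h z - ?p\<bar> \<le> 1 * (\<kappa> / 2)"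
      using c[OF that] \<kappa> by (intro mult_mono) auto
    then have "\<bar>(1 - \<kappa>) * (h z - ?p)\<bar> \<le> \<kappa> / 2"
      using \<kappa> by (simp add: abs_mult)
    moreover have "\<bar>(1 - \<kappa>) * ?p - P z\<bar> \<le> \<kappa> / 2"
      using P(2)[OF that] by (simp add: sum_distrib_left mult.assoc)
    ultimately show ?thesis
      unfolding right_diff_distrib by linarith
  qed
  have "\<bar>h y - P z\<bar> \<le> 10 * \<kappa> \<and> \<bar>P z\<bar> \<le> 1"
    if y: "y \<in> cube" and z: "\<bar>z $ 1\<bar> \<le> r1" "\<bar>z $ 2\<bar> \<le> r2" and yz: "\<bar>y $ 1 - z $ 1\<bar> \<le> e1" "\<bar>y $ 2 - z $ 2\<bar> \<le> e2"
    for y z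
  proof -
    have zc: "z \<in> cube"
      using z inv by (simp add: cube_two_eq)
    have "\<bar>h y - h z\<bar> \<le> L1 * (10 * \<kappa>) + L2 * (10 * \<kappa>)"
      using yz inv L by (intro order_trans[OF lip[OF y zc]] add_mono mult_left_mono) auto
    also have "\<dots> = (L1 + L2) * (10 * \<kappa>)"
      by (simp add: distrib_right)
    also have "\<dots> \<le> 4 / 5 * (10 * \<kappa>)"
      using contr \<kappa> by (intro mult_right_mono) auto
    finally have 1: "\<bar>h y - h z\<bar> \<le> 8 * \<kappa>" by simp
    have hz: "\<bar>h z\<bar> \<le> 1"
      by (rule W_bounded[OF h zc])
    then have "\<kappa> * \<bar>h z\<bar> \<le> \<kappa> * 1"
      using \<kappa> by (intro mult_left_mono) auto
    then have 2: "\<bar>\<kappa> * h z\<bar> \<le> \<kappa>"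
      using \<kappa> by (simp add: abs_mult)
    have "(1 - \<kappa>) * \<bar>h z\<bar> \<le> (1 - \<kappa>) * 1"
      using hz \<kappa> by (intro mult_left_mono) auto
    then have 3: "\<bar>(1 - \<kappa>) * h z\<bar> \<le> 1 - \<kappa>"
      using \<kappa> by (simp add: abs_mult)
    have "(1 - \<kappa>) * h z = h z - \<kappa> * h z"
      by (simp add: algebra_simps)
    with approx[OF zc] 1 2 3 show ?thesis by linarith
  qed
  then show ?thesis
    by (intro bexI[OF _ P(1)] exI[of _ "10 * \<kappa>"] exI[of _ 1]) auto
qed

text \<open>For \<open>m = 1\<close> a constituent need not be a strict contraction, but the sum of its Lipschitz
  constants is at most \<open>1\<close> minus the radius of its range. The error of a node scales with the radii
  \<open>r\<close> of the ranges of its children, so \<open>e + 2 * \<kappa> * r \<le> 4 * \<kappa>\<close> is preserved.\<close>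

lemma node_range_tradeoff:
  fixes h :: "real ^ 2 \<Rightarrow> real"
  assumes h: "h \<in> W 1" and N: "N \<ge> 2"
    and \<kappa>: "0 < \<kappa>" "\<kappa> \<le> 1 / 2" "3 * (1 + pi ^ 4) / N \<le> \<kappa>"
    and inv: "0 \<le> r1 \<and> r1 \<le> 1 \<and> e1 + 2 * \<kappa> * r1 \<le> 4 * \<kappa>" "0 \<le> r2 \<and> r2 \<le> 1 \<and> e2 + 2 * \<kappa> * r2 \<le> 4 * \<kappa>"
  shows "\<exists>P\<in>shallow \<sigma> (N * N). \<exists>e r. (0 \<le> r \<and> r \<le> 1 \<and> e + 2 * \<kappa> * r \<le> 4 * \<kappa>) \<and>
      (\<forall>y (z :: real ^ 2). y \<in> cube \<and> \<bar>z $ 1\<bar> \<le> r1 \<and> \<bar>z $ 2\<bar> \<le> r2 \<and>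
        \<bar>y $ 1 - z $ 1\<bar> \<le> e1 \<and> \<bar>y $ 2 - z $ 2\<bar> \<le> e2 \<longrightarrow> \<bar>h y - P z\<bar> \<le> e \<and> \<bar>P z\<bar> \<le> r)"
proof -
  obtain s L1 L2 where s: "s \<ge> 0" and L: "L1 \<ge> 0" "L2 \<ge> 0" "s + L1 + L2 \<le> 1"
    and cont: "continuous_on cube h" and h_le: "\<forall>x\<in>cube. \<bar>h x\<bar> \<le> s"
    and lip: "\<forall>x\<in>cube. \<forall>y\<in>cube. \<bar>h x - h y\<bar> \<le> L1 * \<bar>x $ 1 - y $ 1\<bar> + L2 * \<bar>x $ 2 - y $ 2\<bar>"
    and "(1::nat) \<ge> 2 \<longrightarrow> L1 + L2 \<le> 4 / 5"
    by (rule W_lipschitz[OF h order_refl])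
  note h_le = h_le[rule_format] and lip = lip[rule_format]
  show ?thesis
  \<comment> \<open>A constant is reproduced exactly, since modulus 1 leaves no room. A nonconstant
    h has 0 < s < 1: at s = 0 it would vanish, and at s = 1 both Lipschitz constants would.\<close>
  proof (cases "\<exists>a. \<forall>x\<in>cube. h x = a")
    case True
    then obtain a where a: "\<And>x. x \<in> cube \<Longrightarrow> h x = a" by blast
    have "\<bar>a\<bar> \<le> 1"
      using W_bounded[OF h, of 0] a[of 0] by (simp add: cube_def)
    moreover have "2 * \<kappa> * \<bar>a\<bar> \<le> 2 * \<kappa> * 1"
      using \<open>\<bar>a\<bar> \<le> 1\<close> \<kappa> by (intro mult_left_mono) auto
    moreover have "(\<lambda>_. a) \<in> shallow \<sigma> (N * N)"
      using N by (intro shallow_const) auto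
    ultimately show ?thesis
      using a \<kappa> by (intro bexI[of _ "\<lambda>_. a"] exI[of _ 0] exI[of _ "\<bar>a\<bar>"]) auto
  next
    case False
    have "s > 0"
    proof (rule ccontr)
      assume "\<not> s > 0"
      then have "\<forall>x\<in>cube. h x = 0"
        using h_le s by (metis abs_le_zero_iff order_antisym not_le)
      with False show False by blast
    qed
    have "s < 1"
    proof (rule ccontr)
      assume "\<not> s < 1"
      then have "L1 = 0" "L2 = 0" using L by auto
      then have "h x = h 0" if "x \<in> cube" for x
        using lip[OF that, of 0] by (simp add: cube_def)
      with False show False by blast
    qed
    \<comment> \<open>The second bound keeps the range within radius 1, as \<kappa> R takes at most
      half of the gap 1 - s; the first is paid for by the slack that s creates in the error
      balance.\<close>
    define \<eta> where "\<eta> = min (\<kappa> * s) ((1 - s) / 2)"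
    have "0 < \<kappa> * s" "0 < (1 - s) / 2"
      using \<open>s > 0\<close> \<open>s < 1\<close> \<kappa>(1) by simp_all
    then have \<eta>: "0 < \<eta>" "\<eta> \<le> \<kappa> * s" "\<eta> \<le> (1 - s) / 2"
      unfolding \<eta>_def by linarith+
    obtain c where c: "\<And>x. \<bar>x $ 1\<bar> \<le> r1 \<Longrightarrow> \<bar>x $ 2\<bar> \<le> r2 \<Longrightarrow>
      \<bar>h x - (\<Sum>k<N. \<Sum>l<N. c k l * (x $ 1) ^ k * (x $ 2) ^ l)\<bar> \<le> 3 * (1 + pi ^ 4) / N * (L1 * r1 + L2 * r2)"
      using lipschitz_polynomial[OF N cont lip L(1,2), of r1 r2] inv by blast
    obtain P :: "real ^ 2 \<Rightarrow> real" where P: "P \<in> shallow \<sigma> (N * N)"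
      "\<And>x. x \<in> cube \<Longrightarrow> \<bar>(\<Sum>k<N. \<Sum>l<N. c k l * (x $ 1) ^ k * (x $ 2) ^ l) - P x\<bar> \<le> \<eta>"
      using polynomial_approximation[OF \<eta>(1)] by blast
    define R where "R = L1 * r1 + L2 * r2"
    define E where "E = L1 * e1 + L2 * e2"
    have "R \<ge> 0" using L inv by (simp add: R_def)
    have R_le: "R \<le> L1 + L2"
      unfolding R_def using L inv by (intro add_mono mult_left_le) auto
    \<comment> \<open>Weighting the children's invariants by the Lipschitz constants yields the
      credit 2 \<kappa> R, which has to cover the approximation error of this node.\<close>
    have "L1 * e1 \<le> L1 * (4 * \<kappa> - 2 * \<kappa> * r1)" "L2 * e2 \<le> L2 * (4 * \<kappa> - 2 * \<kappa> * r2)"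
      using L inv by (intro mult_left_mono; simp)+
    then have E: "E \<le> 4 * (\<kappa> * (L1 + L2)) - 2 * (\<kappa> * R)"
      by (simp add: E_def R_def algebra_simps)
    have half: "2 * (\<kappa> * x) \<le> x" if "x \<ge> 0" for x
      using mult_right_mono[OF \<kappa>(2) that] by simp
    have "\<kappa> * R \<ge> 0"
      using \<kappa>(1) \<open>R \<ge> 0\<close> by simp
    note kR = half[OF \<open>R \<ge> 0\<close>] half[OF this] this
    have k\<eta>: "2 * (\<kappa> * \<eta>) \<le> \<eta>"
      using \<eta>(1) by (intro half) simp
    have kL: "\<kappa> * (L1 + L2) \<le> \<kappa> * (1 - s)"
      using L \<kappa> by (intro mult_left_mono) auto
    have bound: "\<bar>h y - P z\<bar> \<le> E + \<kappa> * R + \<eta> \<and> \<bar>P z\<bar> \<le> s + \<kappa> * R + \<eta>"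
      if y: "y \<in> cube" and z: "\<bar>z $ 1\<bar> \<le> r1" "\<bar>z $ 2\<bar> \<le> r2"
        and yz: "\<bar>y $ 1 - z $ 1\<bar> \<le> e1" "\<bar>y $ 2 - z $ 2\<bar> \<le> e2" for y z
    proof -
      have zc: "z \<in> cube"
        using z inv by (simp add: cube_two_eq)
      have "\<bar>h y - h z\<bar> \<le> E"
        unfolding E_def using yz L by (intro order_trans[OF lip[OF y zc]] add_mono mult_left_mono) auto
      moreover have "3 * (1 + pi ^ 4) / N * R \<le> \<kappa> * R"
        using \<kappa> \<open>R \<ge> 0\<close> by (intro mult_right_mono) auto
      moreover note c[OF z] P(2)[OF zc] h_le[OF zc]
      ultimately show ?thesis
        unfolding R_def[symmetric] by linarith
    qed
    show ?thesis
    proof (rule bexI[OF _ P(1)], rule exI[of _ "E + \<kappa> * R + \<eta>"], rule exI[of _ "s + \<kappa> * R + \<eta>"], intro conjI)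
      show "0 \<le> s + \<kappa> * R + \<eta>"
        using s kR \<eta> by linarith
      show "s + \<kappa> * R + \<eta> \<le> 1"
        using kR(1) R_le L(3) \<eta>(3) unfolding le_divide_eq_numeral1 by linarith
      \<comment> \<open>The balance: \<open>E\<close> leaves 4 \<kappa> s and 2 \<kappa> R unspent.
        The terms in R cost at most 2 \<kappa> R because 2 \<kappa> \<le> 1; the range costs 2
        \<kappa> s, and the terms in \<eta> at most 2 \<eta> \<le> 2 \<kappa> s.\<close>
      have "2 * \<kappa> * (s + \<kappa> * R + \<eta>) = 2 * (\<kappa> * s) + 2 * (\<kappa> * (\<kappa> * R)) + 2 * (\<kappa> * \<eta>)"
        by (simp add: algebra_simps)
      moreover have "\<kappa> * (1 - s) = \<kappa> - \<kappa> * s"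
        by (simp add: algebra_simps)
      ultimately show "E + \<kappa> * R + \<eta> + 2 * \<kappa> * (s + \<kappa> * R + \<eta>) \<le> 4 * \<kappa>"
        using E kR(2,3) k\<eta> kL \<eta>(2) by linarith
    qed (use bound in auto)
  qed
qed

lemma tree_approximation:
  fixes t :: "(real ^ 2 \<Rightarrow> real) btree"
  assumes m: "m \<ge> 1" and N: "N \<ge> 2"
    and \<kappa>: "0 < \<kappa>" "\<kappa> \<le> 1 / 2" "2 * jackson_const m / N ^ m \<le> \<kappa>"
    and t: "set_btree t \<subseteq> W m"
  shows "\<exists>t'. architecture t' = architecture t \<and> set_btree t' \<subseteq> shallow \<sigma> (N * N) \<and>
    (\<forall>x. (\<forall>i\<in>set (leaves t). x i \<in> {-1..1}) \<longrightarrow> \<bar>compose t x - compose t' x\<bar> \<le> 10 * \<kappa>)"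
proof (cases "m = 1")
  case True
  \<comment> \<open>\<open>jackson_const 1\<close> is 12 (1 + pi^4), so the common hypothesis on N
    also covers the Lipschitz estimate.\<close>
  have "3 * (1 + pi ^ 4) / N \<le> 2 * jackson_const m / real N ^ m"
    using True by (simp add: jackson_const_def divide_right_mono)
  with \<kappa> have \<kappa>': "3 * (1 + pi ^ 4) / N \<le> \<kappa>" by linarith
  have "\<exists>t' e r. architecture t' = architecture t \<and> set_btree t' \<subseteq> shallow \<sigma> (N * N) \<and>
    (0 \<le> r \<and> r \<le> 1 \<and> e + 2 * \<kappa> * r \<le> 4 * \<kappa>) \<and>
    (\<forall>x. (\<forall>i\<in>set (leaves t). x i \<in> {-1..1}) \<longrightarrow>
      \<bar>compose t x\<bar> \<le> 1 \<and> \<bar>compose t x - compose t' x\<bar> \<le> e \<and> \<bar>compose t' x\<bar> \<le> r)"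
  proof (rule tree_error_propagation[of "\<lambda>e r. 0 \<le> r \<and> r \<le> 1 \<and> e + 2 * \<kappa> * r \<le> 4 * \<kappa>" "W 1"])
    show "0 \<le> (1::real) \<and> (1::real) \<le> 1 \<and> 0 + 2 * \<kappa> * 1 \<le> 4 * \<kappa>"
      using \<kappa> by simp
    show "set_btree t \<subseteq> W 1"
      using t True by simp
  qed (rule node_range_tradeoff[OF _ N \<kappa>(1,2) \<kappa>'] W_bounded; assumption)+
  then obtain t' e r where t': "architecture t' = architecture t" "set_btree t' \<subseteq> shallow \<sigma> (N * N)"
    and er: "0 \<le> r" "e + 2 * \<kappa> * r \<le> 4 * \<kappa>"
    and e: "\<And>x. (\<forall>i\<in>set (leaves t). x i \<in> {-1..1}) \<Longrightarrow> \<bar>compose t x - compose t' x\<bar> \<le> e"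
    by blast
  have "2 * \<kappa> * r \<ge> 0" using er \<kappa> by simp
  then have "e \<le> 10 * \<kappa>" using er \<kappa> by linarith
  with t' e show ?thesis by (meson order_trans)
next
  case False
  then have m2: "m \<ge> 2" using m by simp
  have \<kappa>1: "\<kappa> \<le> 1" using \<kappa> by simp
  have "\<exists>t' e r. architecture t' = architecture t \<and> set_btree t' \<subseteq> shallow \<sigma> (N * N) \<and>
    (e \<le> 10 * \<kappa> \<and> r \<le> 1) \<and>
    (\<forall>x. (\<forall>i\<in>set (leaves t). x i \<in> {-1..1}) \<longrightarrow>
      \<bar>compose t x\<bar> \<le> 1 \<and> \<bar>compose t x - compose t' x\<bar> \<le> e \<and> \<bar>compose t' x\<bar> \<le> r)"
  proof (rule tree_error_propagation[of "\<lambda>e r. e \<le> 10 * \<kappa> \<and> r \<le> 1" "W m"])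
    show "0 \<le> 10 * \<kappa> \<and> (1::real) \<le> 1"
      using \<kappa> by simp
  qed (rule t node_contraction[OF _ m2 N \<kappa>(1) \<kappa>1 \<kappa>(3)] W_bounded; assumption?)+
  then obtain t' e r where t': "architecture t' = architecture t" "set_btree t' \<subseteq> shallow \<sigma> (N * N)"
    and "e \<le> 10 * \<kappa>"
    and "\<And>x. (\<forall>i\<in>set (leaves t). x i \<in> {-1..1}) \<Longrightarrow> \<bar>compose t x - compose t' x\<bar> \<le> e"
    by blast
  with t' show ?thesis by (meson order_trans)
qed

end

section \<open>Counting units\<close>

lemma length_leaves: "length (leaves t) = Suc (num_nonleaf t)"
  by (induction t) auto

lemma leaves_architecture: "leaves (architecture t) = leaves t"
  by (induction t) auto

theorem theorem2:
  fixes m :: nat and \<sigma> :: "real \<Rightarrow> real"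
  assumes "m \<ge> 1"
    and smooth: "\<And>j x. (deriv ^^ j) \<sigma> field_differentiable (at x)"
    and not_poly: "\<not> (\<exists>p. \<forall>x. \<sigma> x = poly p x)"
  shows "\<exists>C>0. \<forall>n\<ge>2. \<forall>T. tree_on_vars n T \<longrightarrow>
           (\<forall>f \<in> W_comp m n T. \<forall>\<epsilon>::real. 0 < \<epsilon> \<and> \<epsilon> < 1 \<longrightarrow>
             (\<exists>N. real N \<le> C * (real n - 1) * \<epsilon> powr (- 2 / real m) \<and>
               (\<exists>P \<in> deep \<sigma> N T. \<forall>x \<in> ncube n. \<bar>f x - P x\<bar> \<le> \<epsilon>)))"
proof -
  interpret smooth_activation \<sigma>
    by unfold_locales (use smooth not_poly in auto)
  \<comment> \<open>With \<kappa> = \<epsilon> / 10, which turns the error 10 \<kappa> into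
    \<epsilon>, the requirement on the degree bound M reads M^m \<ge> A / \<epsilon>.\<close>
  define A where "A = 20 * jackson_const m"
  have "A > 0"
    using jackson_const_pos[of m] by (simp add: A_def)
  \<comment> \<open>The summand 3 can be absorbed because \<epsilon>^(-1/m) \<ge> 1; so C bounds M
    relative to \<epsilon>^(-1/m), and its square bounds the M * M units of a node.\<close>
  define C where "C = A powr (1 / m) + 3"
  have "C > 0" unfolding C_def by (simp add: add_nonneg_pos)
  have "\<exists>N. real N \<le> C\<^sup>2 * (real n - 1) * \<epsilon> powr (- 2 / real m) \<and>
      (\<exists>P \<in> deep \<sigma> N T. \<forall>x \<in> ncube n. \<bar>f x - P x\<bar> \<le> \<epsilon>)"
    if n: "n \<ge> 2" and T: "tree_on_vars n T" and f: "f \<in> W_comp m n T" and \<epsilon>: "0 < \<epsilon>" "\<epsilon> < 1"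
    for n T f and \<epsilon> :: real
  proof -
    obtain t where t: "architecture t = T" "set_btree t \<subseteq> W m" "\<And>x. x \<in> ncube n \<Longrightarrow> f x = compose t x"
      using f by (auto simp: W_comp_def compositional_def)
    \<comment> \<open>The summand 2 secures M \<ge> 2; together with the rounding it accounts for
      the 3 in \<open>C\<close>.\<close>
    define M where "M = nat \<lceil>(A / \<epsilon>) powr (1 / m)\<rceil> + 2"
    have M2: "M \<ge> 2" by (simp add: M_def)
    have ceil: "(A / \<epsilon>) powr (1 / m) \<le> M" "M \<le> (A / \<epsilon>) powr (1 / m) + 3"
      unfolding M_def by (simp_all, linarith+)
    have "A / \<epsilon> = ((A / \<epsilon>) powr (1 / m)) ^ m"
      using \<open>A > 0\<close> \<epsilon> assms(1) by (simp add: powr_realpow[symmetric] powr_powr)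
    also have "\<dots> \<le> real M ^ m"
      using ceil(1) by (intro power_mono) auto
    finally have "2 * jackson_const m / M ^ m \<le> \<epsilon> / 10"
      using M2 \<epsilon> by (simp add: A_def field_simps)
    then obtain t' where t': "architecture t' = T" "set_btree t' \<subseteq> shallow \<sigma> (M * M)"
      "\<And>x. (\<forall>i\<in>set (leaves t). x i \<in> {-1..1}) \<Longrightarrow> \<bar>compose t x - compose t' x\<bar> \<le> \<epsilon>"
      using tree_approximation[OF assms(1) M2, of "\<epsilon> / 10" t] \<epsilon> t(1,2) by auto
    have leaves: "set (leaves t) = {1..n}" "num_nonleaf T = n - 1"
    proof -
      have "leaves t = leaves T"
        using leaves_architecture[of t] t(1) by simp
      with T show "set (leaves t) = {1..n}"
        by (simp add: tree_on_vars_def)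
      have "length (leaves T) = n"
        using T distinct_card[of "leaves T"] by (simp add: tree_on_vars_def)
      then show "num_nonleaf T = n - 1"
        using length_leaves[of T] by simp
    qed
    have "compose t' \<in> deep \<sigma> ((n - 1) * (M * M)) T"
      using t' leaves by (auto simp: deep_def compositional_def intro!: exI[of _ "M * M"])
    moreover have "\<bar>f x - compose t' x\<bar> \<le> \<epsilon>" if "x \<in> ncube n" for x
      using that t(3) t'(3)[of x] leaves by (simp add: ncube_def)
    moreover have "real ((n - 1) * (M * M)) \<le> C\<^sup>2 * (real n - 1) * \<epsilon> powr (- 2 / real m)"
    proof -
      have "(A / \<epsilon>) powr (1 / m) = A powr (1 / m) * \<epsilon> powr (- 1 / m)"
        using \<open>A > 0\<close> \<epsilon> by (simp add: powr_divide powr_minus_divide)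
      moreover have "1 \<le> \<epsilon> powr (- 1 / m)"
        using \<epsilon> powr_le1[of "1 / m" \<epsilon>] by (simp add: powr_minus_divide)
      ultimately have "real M \<le> C * \<epsilon> powr (- 1 / m)"
        using ceil(2) by (simp add: C_def distrib_right)
      then have "real M * real M \<le> (C * \<epsilon> powr (- 1 / m)) * (C * \<epsilon> powr (- 1 / m))"
        using \<open>C > 0\<close> by (intro mult_mono) auto
      also have "\<dots> = C\<^sup>2 * \<epsilon> powr (- 2 / m)"
        by (simp add: power2_eq_square powr_add[symmetric])
      finally have "(real n - 1) * (real M * real M) \<le> (real n - 1) * (C\<^sup>2 * \<epsilon> powr (- 2 / m))"
        using n by (intro mult_left_mono) auto
      then show ?thesis
        using n by (simp add: of_nat_diff mult_ac)
    qed
    ultimately show ?thesis by blast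
  qed
  with \<open>C > 0\<close> show ?thesis
    by (intro exI[of _ "C\<^sup>2"]) auto
qed

end
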